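(* Let $E$ be a finite set and let $L\subseteq\{\pm1\}^E$. The following statements are equivalent: (i) $L$ is ample; (ii) $|L|$ is weakly convex; (iii) $|L|$ is sign-convex; (iv) $\mathrm{Baryc}(L)$ is sign-convex; (v) $L$ is isometric and every face of $|L|$ is gated in $(|L|,d_{|L|})$; (vi) the restrictions of the intrinsic metric $d_{|L|}$ and of the $\ell_1$-metric $d$ to $\mathrm{Baryc}(L)$ coincide; (vii) for the barycenters $t_1,t_2$ of any two parallel faces of $|L|$ one has $d_{|L|}(t_1,t_2)=d(t_1,t_2)$.
   Context: $E$ is a finite set; $\{\pm1\}^E$, $\{\pm1,0\}^E$, $\mathbb R^E$ are the sets of maps from $E$ to $\{-1,+1\}$, $\{-1,0,+1\}$, $\mathbb R$. The $\ell_1$-metric on $\mathbb R^E$ is $d(r',r'')=\sum_{e\in E}|r'(e)-r''(e)|$. Ampleness: a set $A\subseteq E$ is shattered by $L\subseteq\{\pm1\}^E$ if $\{s|_A: s\in L\}=\{\pm1\}^A$. $L$ is ample if $\#L$ equals the number of subsets $A\subseteq E$ (including possibly $A=\varnothing$) shattered by $L$. Isometric: $G(L)$ is the graph with vertex set $L$ in which $s',s''$ are adjacent iff they differ in exactly one coordinate, i.e. $d(s',s'')=2$; every edge has length 2. $L$ is isometric if any $s',s''\in L$ can be joined in $G(L)$ by a path of length $d(s',s'')$. Cubihedron: $H(E)=[-1,+1]^E$. A face of $H(E)$ is a set $F=\{r\in H(E): r|_{E-A}=s_0\}$ with $A\subseteq E$ and $s_0\in\{\pm1\}^{E-A}$ (so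 vertices, with $A=\varnothing$, and $H(E)$ itself are faces). Its barycenter is the map in $\{\pm1,0\}^E$ equal to $0$ on $A$ and to $s_0$ on $E-A$. Two faces are parallel if they have the same set $A$. The geometric realization (cubihedron) $|L|\subseteq H(E)$ is the union of (the cube complex consisting of) all faces $F$ of $H(E)$ with $F\cap\{\pm1\}^E\subseteq L$; these faces are the faces of $|L|$. $\mathrm{Baryc}(L)\subseteq\{\pm1,0\}^E$ is the set of barycenters of all faces of $|L|$. Intrinsic metric: $d_{|L|}(x,y)\in[0,\infty]$ is the infimum of the $d$-lengths of curves (continuous maps $[0,1]\to|L|$) from $x$ to $y$ in $|L|$ (it is $\infty$ if there is no rectifiable curve), where the $d$-length of a curve $\gamma$ is $\sup\sum_{i=1}^k d(\gamma(t_{i-1}),\gamma(t_i))$ over all $0\le t_0\le\dots\le t_k\le1$. Gated: a subset $F$ of a metric space $(M,\rho)$ is gated if for every $r\in M$ there is $r'\in F$ with $\rho(r,q)=\rho(r,r')+\rho(r',q)$ for all $q\in F$. Weakly convex: $K\subseteq\mathbb R^E$ is weakly convex if $(K,d)$ is complete and for any two distinct $r',r''\in K$ there is $r\in K$, $r\ne r',r''$, with $d(r',r'')=d(r',r)+d(r,r'')$. Sign-convex: $K\subseteq\mathbb R^E$ is sign-convex if for any two distinct $r',r''\in K$ and every $e\in E$ with $r'(e)r''(e)<0$ there is $r\in K$ with $r(e)=0$ and $\mathrm{sign}(r(f))\in\{\mathrm{sign}(r'(f)),\mathrm{sign}(r''(f))\}$ for all $f\in E$ with $r'(f)r''(f)\ge0$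 (with $\mathrm{sign}$ taking values in $\{-1,0,+1\}$). *)

theory Defs
  imports "HOL-Analysis.Analysis"
begin

text \<open>A map from \<open>E\<close> to a set \<open>S\<close> of reals is an element of \<open>E \<rightarrow>\<^sub>E S\<close>, i.e. a function of
  type \<open>'a \<Rightarrow> real\<close> that is \<open>undefined\<close> outside \<open>E\<close>. Since \<open>E\<close> is an explicit set, it may be
  empty.\<close>

definition sign_maps :: "'a set \<Rightarrow> ('a \<Rightarrow> real) set" where
  "sign_maps E = E \<rightarrow>\<^sub>E {-1, 1}"

definition l1_dist :: "'a set \<Rightarrow> ('a \<Rightarrow> real) \<Rightarrow> ('a \<Rightarrow> real) \<Rightarrow> real" where
  "l1_dist E r r' = (\<Sum>e\<in>E. \<bar>r e - r' e\<bar>)"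

lemma Metric_space_l1_dist:
  assumes "finite E" and "K \<subseteq> extensional E"
  shows "Metric_space K (l1_dist E)"
proof
  fix x y z
  show "0 \<le> l1_dist E x y"
    by (simp add: l1_dist_def sum_nonneg)
  show "l1_dist E x y = l1_dist E y x"
    by (simp add: l1_dist_def abs_minus_commute)
  show "(l1_dist E x y = 0) = (x = y)" if "x \<in> K" "y \<in> K"
  proof
    assume "l1_dist E x y = 0"
    then have "\<forall>e\<in>E. x e = y e"
      using assms(1) by (simp add: l1_dist_def sum_nonneg_eq_0_iff)
    then show "x = y"
      using that assms(2) by (blast intro: extensionalityI)
  qed (simp add: l1_dist_def)
  show "l1_dist E x z \<le> l1_dist E x y + l1_dist E y z"
    unfolding l1_dist_def sum.distrib[symmetric] by (rule sum_mono) linarith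
qed


definition shattered :: "'a set \<Rightarrow> ('a \<Rightarrow> real) set \<Rightarrow> bool" where
  "shattered A L \<longleftrightarrow> (\<lambda>s. restrict s A) ` L = sign_maps A"

definition ample :: "'a set \<Rightarrow> ('a \<Rightarrow> real) set \<Rightarrow> bool" where
  "ample E L \<longleftrightarrow> card L = card {A. A \<subseteq> E \<and> shattered A L}"


definition adjacent :: "'a set \<Rightarrow> ('a \<Rightarrow> real) \<Rightarrow> ('a \<Rightarrow> real) \<Rightarrow> bool" where
  "adjacent E s s' \<longleftrightarrow> card {e \<in> E. s e \<noteq> s' e} = 1"

text \<open>A path is given by its list of vertices; each of its edges has length 2.\<close>

definition isometric :: "'a set \<Rightarrow> ('a \<Rightarrow> real) set \<Rightarrow> bool" where
  "isometric E L \<longleftrightarrow>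
    (\<forall>s\<in>L. \<forall>s'\<in>L. \<exists>p. p \<noteq> [] \<and> distinct p \<and> set p \<subseteq> L \<and> successively (adjacent E) p \<and>
      hd p = s \<and> last p = s' \<and> 2 * real (length p - 1) = l1_dist E s s')"


definition cube :: "'a set \<Rightarrow> ('a \<Rightarrow> real) set" where
  "cube E = E \<rightarrow>\<^sub>E {-1..1}"

definition cube_face :: "'a set \<Rightarrow> 'a set \<Rightarrow> ('a \<Rightarrow> real) \<Rightarrow> ('a \<Rightarrow> real) set" where
  "cube_face E A s\<^sub>0 = {r \<in> cube E. restrict r (E - A) = s\<^sub>0}"

definition barycenter :: "'a set \<Rightarrow> 'a set \<Rightarrow> ('a \<Rightarrow> real) \<Rightarrow> 'a \<Rightarrow> real" where
  "barycenter E A s\<^sub>0 = (\<lambda>e\<in>E. if e \<in> A then 0 else s\<^sub>0 e)"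

text \<open>The faces of the cubihedron \<open>|L|\<close> are handled through the pairs \<open>(A, s\<^sub>0)\<close> defining them.
  By \<open>cube_face_inject\<close> below, a face determines its pair, so the barycenter and the direction \<open>A\<close>
  depend only on the face.\<close>

definition face_pairs :: "'a set \<Rightarrow> ('a \<Rightarrow> real) set \<Rightarrow> ('a set \<times> ('a \<Rightarrow> real)) set" where
  "face_pairs E L =
    {(A, s\<^sub>0). A \<subseteq> E \<and> s\<^sub>0 \<in> sign_maps (E - A) \<and> cube_face E A s\<^sub>0 \<inter> sign_maps E \<subseteq> L}"

definition faces :: "'a set \<Rightarrow> ('a \<Rightarrow> real) set \<Rightarrow> ('a \<Rightarrow> real) set set" where
  "faces E L = {cube_face E A s\<^sub>0 | A s\<^sub>0. (A, s\<^sub>0) \<in> face_pairs E L}"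

definition realization :: "'a set \<Rightarrow> ('a \<Rightarrow> real) set \<Rightarrow> ('a \<Rightarrow> real) set" where
  "realization E L = \<Union> (faces E L)"

definition Baryc :: "'a set \<Rightarrow> ('a \<Rightarrow> real) set \<Rightarrow> ('a \<Rightarrow> real) set" where
  "Baryc E L = {barycenter E A s\<^sub>0 | A s\<^sub>0. (A, s\<^sub>0) \<in> face_pairs E L}"

lemma barycenter_in_cube_face:
  assumes "A \<subseteq> E" and "s \<in> sign_maps (E - A)"
  shows "barycenter E A s \<in> cube_face E A s"
proof -
  have pm: "s e = -1 \<or> s e = 1" if "e \<in> E - A" for e
    using PiE_mem[OF assms(2)[unfolded sign_maps_def] that] by simp
  have "barycenter E A s \<in> cube E"
    unfolding cube_def
  proof (rule PiE_I)
    fix e assume "e \<in> E"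
    then show "barycenter E A s e \<in> {-1..1}"
      using pm[of e] by (auto simp: barycenter_def)
  qed (simp add: barycenter_def)
  moreover have "restrict (barycenter E A s) (E - A) = s"
    using assms(2) by (intro extensionalityI[of _ "E - A"])
      (auto simp: barycenter_def sign_maps_def PiE_iff)
  ultimately show ?thesis
    by (simp add: cube_face_def)
qed

lemma cube_face_inject:
  assumes "A \<subseteq> E" "s \<in> sign_maps (E - A)" "B \<subseteq> E" "t \<in> sign_maps (E - B)"
    and eq: "cube_face E A s = cube_face E B t"
  shows "A = B \<and> s = t"
proof -
  have sub: "A' \<subseteq> B'"
    if A': "A' \<subseteq> E" "s' \<in> sign_maps (E - A')" and t': "t' \<in> sign_maps (E - B')"
      and "cube_face E A' s' = cube_face E B' t'" for A' B' s' t'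
  proof
    fix e assume e: "e \<in> A'"
    show "e \<in> B'"
    proof (rule ccontr)
      assume "e \<notin> B'"
      then have eB: "e \<in> E - B'"
        using e A'(1) by blast
      have "restrict (barycenter E A' s') (E - B') = t'"
        using barycenter_in_cube_face[OF A', unfolded that(4)] by (simp add: cube_face_def)
      then have "t' e = 0"
        using e eB by (auto simp: barycenter_def)
      moreover have "t' e \<in> {-1, 1}"
        using PiE_mem[OF t'[unfolded sign_maps_def] eB] .
      ultimately show False
        by simp
    qed
  qed
  have "A = B"
    using sub[OF assms(1,2,4) eq] sub[OF assms(3,4,2) eq[symmetric]] by blast
  moreover have "s = t"
    using barycenter_in_cube_face[OF assms(1,2)] eq \<open>A = B\<close> by (auto simp: cube_face_def)
  ultimately show ?thesis ..
qed


definition curve_length :: "'a set \<Rightarrow> (real \<Rightarrow> 'a \<Rightarrow> real) \<Rightarrow> ennreal" where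
  "curve_length E \<gamma> =
    (SUP (k, t) \<in> {(k :: nat, t :: nat \<Rightarrow> real). mono_on {..k} t \<and> t ` {..k} \<subseteq> {0..1}}.
      ennreal (\<Sum>i=1..k. l1_dist E (\<gamma> (t (i - 1))) (\<gamma> (t i))))"

definition intrinsic_dist ::
  "'a set \<Rightarrow> ('a \<Rightarrow> real) set \<Rightarrow> ('a \<Rightarrow> real) \<Rightarrow> ('a \<Rightarrow> real) \<Rightarrow> ennreal" where
  "intrinsic_dist E L x y =
    (INF \<gamma> \<in> {\<gamma>. continuous_map (top_of_set {0..1})
                    (Metric_space.mtopology (realization E L) (l1_dist E)) \<gamma> \<and>
                  \<gamma> 0 = x \<and> \<gamma> 1 = y}.
      curve_length E \<gamma>)"

definition gated :: "'b set \<Rightarrow> ('b \<Rightarrow> 'b \<Rightarrow> ennreal) \<Rightarrow> 'b set \<Rightarrow> bool" where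
  "gated M \<rho> F \<longleftrightarrow> F \<subseteq> M \<and> (\<forall>r\<in>M. \<exists>r'\<in>F. \<forall>q\<in>F. \<rho> r q = \<rho> r r' + \<rho> r' q)"


definition weakly_convex :: "'a set \<Rightarrow> ('a \<Rightarrow> real) set \<Rightarrow> bool" where
  "weakly_convex E K \<longleftrightarrow>
    Metric_space.mcomplete K (l1_dist E) \<and>
    (\<forall>r'\<in>K. \<forall>r''\<in>K. r' \<noteq> r'' \<longrightarrow>
      (\<exists>r\<in>K. r \<noteq> r' \<and> r \<noteq> r'' \<and> l1_dist E r' r'' = l1_dist E r' r + l1_dist E r r''))"

definition sign_convex :: "'a set \<Rightarrow> ('a \<Rightarrow> real) set \<Rightarrow> bool" where
  "sign_convex E K \<longleftrightarrow>
    (\<forall>r'\<in>K. \<forall>r''\<in>K. r' \<noteq> r'' \<longrightarrow>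
      (\<forall>e\<in>E. r' e * r'' e < 0 \<longrightarrow>
        (\<exists>r\<in>K. r e = 0 \<and>
          (\<forall>f\<in>E. r' f * r'' f \<ge> 0 \<longrightarrow> sgn (r f) \<in> {sgn (r' f), sgn (r'' f)}))))"

end

theory Submission
  imports Defs
begin

text \<open>All conditions are compared with the midface property below, a statement about pairs of
  barycenters of parallel faces. It makes a coordinate flip towards the other barycenter
  possible inside the complex, so that any two points of the cubihedron are joined by a path that
  changes one coordinate after the other. Such a path is a geodesic for the \<open>l\<^sub>1\<close>-metric; all
  metric and sign-convexity statements follow from it.

  Ampleness passes to the two fibers over a coordinate and to their intersection, which gives
  the midface property by induction on \<open>E\<close>. Conversely, sign-convexity of the barycenters turns
  every shattered set into the direction of a face, and the number of directions of faces never
  exceeds the number of elements of \<open>L\<close>.\<close>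

text \<open>The faces are eliminated at once: by \<open>realization_iff\<close>, a point of the cube
  lies in |L| exactly when every sign map that agrees with its coordinates 1 and -1 lies in
  \<open>L\<close>. Pushing an interior coordinate to 1 or -1 therefore never leaves |L|.

  The inheritance of ampleness rests on the sandwich theorem: \<open>L\<close> has at most as many
  elements as shattered sets and at least as many as directions of faces. Both inequalities are
  proved by splitting along a coordinate. Ampleness is equality in the first one, and equality
  forces equality in every estimate of the inductive step.

  The obstacle on the metric side is that the intrinsic distance is an infimum. It only supplies
  curves that may be slightly too long, and these may leave a coordinate common to \<open>x\<close>
  and \<open>y\<close>. This is why the midface property tolerates an interior value of
  \<open>z\<close> at such a coordinate. An exact flip is recovered from this weak witness by
  induction on the number of coordinates at which \<open>x\<close> and \<open>y\<close>
  differ.\<close>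

lemma finite_sign_maps: "finite E \<Longrightarrow> finite (sign_maps E)"
  by (simp add: sign_maps_def finite_PiE)

lemma sign_maps_iff: "s \<in> sign_maps E \<longleftrightarrow> s \<in> extensional E \<and> (\<forall>e\<in>E. s e = -1 \<or> s e = 1)"
  by (auto simp: sign_maps_def PiE_iff)

lemma sign_maps_abs: "s \<in> sign_maps E \<Longrightarrow> e \<in> E \<Longrightarrow> \<bar>s e\<bar> = 1"
  by (fastforce simp: sign_maps_iff)

lemma sign_maps_extensional: "s \<in> sign_maps E \<Longrightarrow> s \<in> extensional E"
  by (simp add: sign_maps_iff)

lemma cube_iff: "x \<in> cube E \<longleftrightarrow> x \<in> extensional E \<and> (\<forall>e\<in>E. \<bar>x e\<bar> \<le> 1)"
  by (auto simp: cube_def PiE_iff abs_le_iff)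

text \<open>The smallest face of the cube through \<open>z\<close> frees exactly the coordinates of
  absolute value below 1, and its vertices are the maps \<open>r\<close> on the right. Every face of
  |L| through \<open>z\<close> contains it, so it decides membership.\<close>

lemma realization_iff:
  "z \<in> realization E L \<longleftrightarrow>
    z \<in> cube E \<and> (\<forall>r\<in>sign_maps E. (\<forall>e\<in>E. \<bar>z e\<bar> = 1 \<longrightarrow> r e = z e) \<longrightarrow> r \<in> L)"
proof (intro iffI conjI ballI impI)
  assume "z \<in> realization E L"
  then obtain A s where A: "A \<subseteq> E" "s \<in> sign_maps (E - A)" "cube_face E A s \<inter> sign_maps E \<subseteq> L"
    and z: "z \<in> cube_face E A s"
    by (auto simp: realization_def faces_def face_pairs_def)
  show "z \<in> cube E" using z by (simp add: cube_face_def)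
  fix r assume r: "r \<in> sign_maps E" "\<forall>e\<in>E. \<bar>z e\<bar> = 1 \<longrightarrow> r e = z e"
  have zs: "z e = s e" if "e \<in> E - A" for e
    using z that by (auto simp: cube_face_def)
  have "restrict r (E - A) = s"
  proof (rule extensionalityI[of _ "E - A"])
    fix e assume e: "e \<in> E - A"
    then have "\<bar>z e\<bar> = 1" using sign_maps_abs[OF A(2) e] zs[OF e] by simp
    then show "restrict r (E - A) e = s e" using e r(2) zs[OF e] by auto
  qed (use A(2) in \<open>auto simp: sign_maps_iff\<close>)
  moreover have "r \<in> cube E" using r(1) by (auto simp: sign_maps_iff cube_iff)
  ultimately show "r \<in> L" using A(3) r(1) by (auto simp: cube_face_def)
next
  assume z: "z \<in> cube E \<and> (\<forall>r\<in>sign_maps E. (\<forall>e\<in>E. \<bar>z e\<bar> = 1 \<longrightarrow> r e = z e) \<longrightarrow> r \<in> L)"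
  define A where "A = {e \<in> E. \<bar>z e\<bar> \<noteq> 1}"
  have EA: "\<And>e. e \<in> E - A \<longleftrightarrow> e \<in> E \<and> \<bar>z e\<bar> = 1" by (auto simp: A_def)
  have "restrict z (E - A) \<in> sign_maps (E - A)"
    using EA by (force simp: sign_maps_iff abs_if split: if_splits)
  moreover have "cube_face E A (restrict z (E - A)) \<inter> sign_maps E \<subseteq> L"
  proof
    fix r assume r: "r \<in> cube_face E A (restrict z (E - A)) \<inter> sign_maps E"
    then have eq: "restrict r (E - A) = restrict z (E - A)" by (simp add: cube_face_def)
    have "r e = z e" if "e \<in> E" "\<bar>z e\<bar> = 1" for e
      using fun_cong[OF eq, of e] that EA[of e] by (simp add: restrict_def split: if_splits)
    then show "r \<in> L" using z r by auto
  qed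
  ultimately have "(A, restrict z (E - A)) \<in> face_pairs E L"
    by (auto simp: face_pairs_def A_def)
  moreover have "z \<in> cube_face E A (restrict z (E - A))"
    using z by (simp add: cube_face_def)
  ultimately show "z \<in> realization E L"
    by (auto simp: realization_def faces_def)
qed

lemma realizationD:
  assumes "z \<in> realization E L" "r \<in> sign_maps E" "\<And>e. e \<in> E \<Longrightarrow> \<bar>z e\<bar> = 1 \<Longrightarrow> r e = z e"
  shows "r \<in> L"
  using assms by (auto simp: realization_iff)

lemma realization_subset_extensional: "realization E L \<subseteq> extensional E"
  by (auto simp: realization_iff cube_iff)

lemma realization_abs_le: "z \<in> realization E L \<Longrightarrow> e \<in> E \<Longrightarrow> \<bar>z e\<bar> \<le> 1"
  by (auto simp: realization_iff cube_iff)

lemma sign_maps_Int_realization: "sign_maps E \<inter> realization E L = sign_maps E \<inter> L"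
proof -
  have "s \<in> realization E L \<longleftrightarrow> s \<in> L" if s: "s \<in> sign_maps E" for s
  proof
    assume "s \<in> realization E L" then show "s \<in> L" using s by (auto elim: realizationD)
  next
    assume L: "s \<in> L"
    note one = sign_maps_abs[OF s]
    have "r = s" if "r \<in> sign_maps E" "\<forall>e\<in>E. \<bar>s e\<bar> = 1 \<longrightarrow> r e = s e" for r
      using that s one by (intro extensionalityI[of _ E]) (auto simp: sign_maps_iff)
    moreover have "s \<in> cube E" using s one by (auto simp: cube_iff sign_maps_iff)
    ultimately show "s \<in> realization E L"
      using L unfolding realization_iff by blast
  qed
  then show ?thesis by auto
qed

lemma realization_Int: "realization E (K \<inter> L) = realization E K \<inter> realization E L"
  by (auto simp: realization_iff)

lemma realization_mono: "K \<subseteq> L \<Longrightarrow> realization E K \<subseteq> realization E L"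
  unfolding realization_iff subset_iff by blast

text \<open>The smallest face through a barycenter is the face itself, so this single point decides
  whether the whole face belongs to |L|.\<close>

lemma barycenter_in_realization_iff:
  assumes "A \<subseteq> E" "s \<in> sign_maps (E - A)"
  shows "barycenter E A s \<in> realization E L \<longleftrightarrow> (A, s) \<in> face_pairs E L"
proof -
  have s: "s e = -1 \<or> s e = 1" if "e \<in> E" "e \<notin> A" for e
    using assms(2) that by (auto simp: sign_maps_iff)
  have b: "barycenter E A s \<in> cube E"
    using barycenter_in_cube_face[OF assms] by (simp add: cube_face_def)
  have eq: "(\<forall>e\<in>E. \<bar>barycenter E A s e\<bar> = 1 \<longrightarrow> r e = barycenter E A s e) \<longleftrightarrow> r \<in> cube_face E A s"
    if r: "r \<in> sign_maps E" for r
  proof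
    assume H: "\<forall>e\<in>E. \<bar>barycenter E A s e\<bar> = 1 \<longrightarrow> r e = barycenter E A s e"
    have "restrict r (E - A) = s"
    proof (rule extensionalityI[of _ "E - A"])
      fix e assume "e \<in> E - A"
      then show "restrict r (E - A) e = s e" using H s[of e] by (auto simp: barycenter_def)
    qed (use assms in \<open>auto simp: sign_maps_iff\<close>)
    then show "r \<in> cube_face E A s"
      using r by (auto simp: cube_face_def cube_iff sign_maps_iff)
  next
    assume "r \<in> cube_face E A s"
    then have eq: "restrict r (E - A) = s" by (simp add: cube_face_def)
    show "\<forall>e\<in>E. \<bar>barycenter E A s e\<bar> = 1 \<longrightarrow> r e = barycenter E A s e"
      by (auto simp: barycenter_def simp flip: eq)
  qed
  show ?thesis
    using b eq assms by (auto simp: realization_iff face_pairs_def)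
qed

lemma Baryc_iff: "x \<in> Baryc E L \<longleftrightarrow> x \<in> realization E L \<and> (\<forall>e\<in>E. x e \<in> {-1, 0, 1})"
proof
  assume "x \<in> Baryc E L"
  then obtain A s where A: "(A, s) \<in> face_pairs E L" "x = barycenter E A s"
    by (auto simp: Baryc_def)
  then have "A \<subseteq> E" "s \<in> sign_maps (E - A)" by (auto simp: face_pairs_def)
  then show "x \<in> realization E L \<and> (\<forall>e\<in>E. x e \<in> {-1, 0, 1})"
    using A barycenter_in_realization_iff[of A E s L]
    by (auto simp: barycenter_def sign_maps_iff)
next
  assume x: "x \<in> realization E L \<and> (\<forall>e\<in>E. x e \<in> {-1, 0, 1})"
  define A where "A = {e\<in>E. x e = 0}"
  have "restrict x (E - A) \<in> sign_maps (E - A)" using x by (auto simp: sign_maps_iff A_def)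
  moreover have "barycenter E A (restrict x (E - A)) = x"
    using x realization_subset_extensional[of E L]
    by (intro extensionalityI[of _ E]) (auto simp: barycenter_def A_def)
  ultimately show "x \<in> Baryc E L"
    using barycenter_in_realization_iff[of A E "restrict x (E - A)" L] x
    by (auto simp: Baryc_def A_def intro!: exI[of _ A] exI[of _ "restrict x (E - A)"])
qed

text \<open>Carries condition (vii) from pairs of faces over to points: the direction
  \<open>A\<close> is the zero set of the barycenter. The predicate \<open>P\<close> will be the
  equality of the two distances.\<close>

lemma parallel_Baryc_iff:
  "(\<forall>A s\<^sub>1 s\<^sub>2. (A, s\<^sub>1) \<in> face_pairs E L \<longrightarrow> (A, s\<^sub>2) \<in> face_pairs E L \<longrightarrow>
      P (barycenter E A s\<^sub>1) (barycenter E A s\<^sub>2)) \<longleftrightarrow>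
   (\<forall>x\<in>Baryc E L. \<forall>y\<in>Baryc E L. (\<forall>e\<in>E. x e = 0 \<longleftrightarrow> y e = 0) \<longrightarrow> P x y)" (is "?l \<longleftrightarrow> ?r")
proof
  have zero: "{e\<in>E. barycenter E A s e = 0} = A" if "(A, s) \<in> face_pairs E L" for A s
  proof -
    have "A \<subseteq> E" "s \<in> sign_maps (E - A)" using that by (auto simp: face_pairs_def)
    moreover from this have "s e \<noteq> 0" if "e \<in> E - A" for e using sign_maps_abs[OF _ that] by fastforce
    ultimately show ?thesis by (auto simp: barycenter_def)
  qed
  {
    assume l: ?l
    show ?r
    proof (intro ballI impI)
      fix x y assume "x \<in> Baryc E L" "y \<in> Baryc E L" and par: "\<forall>e\<in>E. x e = 0 \<longleftrightarrow> y e = 0"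
      then obtain A s B t where A: "(A, s) \<in> face_pairs E L" "x = barycenter E A s"
         and B: "(B, t) \<in> face_pairs E L" "y = barycenter E B t"
        by (auto simp: Baryc_def)
      have "A = B" using zero[OF A(1)] zero[OF B(1)] par A(2) B(2) by auto
      then show "P x y" using l A B by blast
    qed
  next
    assume r: ?r
    show ?l
    proof (intro allI impI)
      fix A s t assume st: "(A, s) \<in> face_pairs E L" "(A, t) \<in> face_pairs E L"
      then have "barycenter E A s \<in> Baryc E L" "barycenter E A t \<in> Baryc E L"
        by (auto simp: Baryc_def)
      moreover have "\<forall>e\<in>E. barycenter E A s e = 0 \<longleftrightarrow> barycenter E A t e = 0"
        using zero[OF st(1)] zero[OF st(2)] by blast
      ultimately show "P (barycenter E A s) (barycenter E A t)" using r by blast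
    qed
  }
qed

subsection \<open>Shattered sets and fibers\<close>

text \<open>Here \<open>E\<close> is the ground set with \<open>e\<close> removed, so that induction
  on the ground set applies. The union of the fibers over 1 and -1 is the projection of
  \<open>L\<close>; their intersection represents the edges of \<open>L\<close> in direction
  \<open>e\<close>.\<close>

definition fiber :: "'a set \<Rightarrow> 'a \<Rightarrow> real \<Rightarrow> ('a \<Rightarrow> real) set \<Rightarrow> ('a \<Rightarrow> real) set" where
  "fiber E e c L = {s \<in> sign_maps E. s(e := c) \<in> L}"

lemma fiber_subset: "fiber E e c L \<subseteq> sign_maps E"
  by (auto simp: fiber_def)

lemma sign_maps_upd:
  assumes "s \<in> sign_maps E" "c = -1 \<or> c = 1"
  shows "s(e := c) \<in> sign_maps (insert e E)"
  using assms by (auto simp: sign_maps_iff extensional_def)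

lemma sign_maps_restrict: "s \<in> sign_maps E \<Longrightarrow> A \<subseteq> E \<Longrightarrow> restrict s A \<in> sign_maps A"
  by (auto simp: sign_maps_iff)

lemma restrict_upd_insert: "x \<in> extensional (insert e E) \<Longrightarrow> (restrict x E)(e := x e) = x"
  by (auto simp: extensional_def fun_eq_iff restrict_def)

lemma card_fibers:
  assumes "finite E" "e \<notin> E" "L \<subseteq> sign_maps (insert e E)"
  shows "card L = card (fiber E e 1 L) + card (fiber E e (-1) L)"
proof -
  have c: "card {s \<in> L. s e = c} = card (fiber E e c L)" if "c = -1 \<or> c = 1" for c
  proof (rule bij_betw_same_card[symmetric], rule bij_betw_byWitness[where f = "\<lambda>s. s(e := c)" and f' = "\<lambda>s. restrict s E"])
    show "\<forall>s\<in>fiber E e c L. restrict (s(e := c)) E = s"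
      using assms(2) by (auto simp: fiber_def sign_maps_iff extensional_def restrict_def fun_eq_iff)
    show "\<forall>s\<in>{s \<in> L. s e = c}. (restrict s E)(e := c) = s"
    proof
      fix s assume s: "s \<in> {s \<in> L. s e = c}"
      then have "s \<in> extensional (insert e E)" using assms(3) by (auto simp: sign_maps_iff)
      from restrict_upd_insert[OF this] show "(restrict s E)(e := c) = s" using s by simp
    qed
    then show "(\<lambda>s. restrict s E) ` {s \<in> L. s e = c} \<subseteq> fiber E e c L"
      using assms(3) sign_maps_restrict[OF _ subset_insertI] by (fastforce simp: fiber_def)
    show "(\<lambda>s. s(e := c)) ` fiber E e c L \<subseteq> {s \<in> L. s e = c}"
      by (auto simp: fiber_def)
  qed
  have fin: "finite L" using assms finite_sign_maps[of "insert e E"] finite_subset by blast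
  have "L = {s \<in> L. s e = 1} \<union> {s \<in> L. s e = -1}" using assms(3) by (auto simp: sign_maps_iff)
  then have "card L = card ({s \<in> L. s e = 1} \<union> {s \<in> L. s e = -1})" by simp
  also have "\<dots> = card {s \<in> L. s e = 1} + card {s \<in> L. s e = -1}"
    using fin by (intro card_Un_disjoint) auto
  finally show ?thesis by (simp add: c)
qed

lemma shattered_iff:
  assumes "L \<subseteq> sign_maps E" "A \<subseteq> E"
  shows "shattered A L \<longleftrightarrow> (\<forall>a\<in>sign_maps A. \<exists>s\<in>L. \<forall>e\<in>A. s e = a e)"
proof -
  have "(\<lambda>s. restrict s A) ` L \<subseteq> sign_maps A"
    using assms sign_maps_restrict by blast
  moreover have "a \<in> (\<lambda>s. restrict s A) ` L \<longleftrightarrow> (\<exists>s\<in>L. \<forall>e\<in>A. s e = a e)"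
    if "a \<in> sign_maps A" for a
  proof -
    have "a = restrict s A \<longleftrightarrow> (\<forall>e\<in>A. s e = a e)" for s
      using that by (auto simp: sign_maps_iff extensional_def restrict_def fun_eq_iff)
    then show ?thesis by (auto simp: image_iff)
  qed
  ultimately show ?thesis unfolding shattered_def by auto
qed

definition shattered_sets :: "'a set \<Rightarrow> ('a \<Rightarrow> real) set \<Rightarrow> 'a set set" where
  "shattered_sets E L = {A. A \<subseteq> E \<and> shattered A L}"

lemma ample_iff: "ample E L \<longleftrightarrow> card L = card (shattered_sets E L)"
  by (simp add: ample_def shattered_sets_def)

lemma finite_shattered_sets: "finite E \<Longrightarrow> finite (shattered_sets E L)"
  by (auto simp: shattered_sets_def)

lemma shattered_sets_mono:
  assumes "K \<subseteq> L" "L \<subseteq> sign_maps E"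
  shows "shattered_sets E K \<subseteq> shattered_sets E L"
proof -
  have "K \<subseteq> sign_maps E" using assms by auto
  then show ?thesis
    using assms unfolding shattered_sets_def
    by (auto simp: shattered_iff[of K E] shattered_iff[of L E]) blast
qed

lemma shattered_Un_fibers_iff:
  assumes "e \<notin> E" "L \<subseteq> sign_maps (insert e E)" "A \<subseteq> E"
  shows "shattered A L \<longleftrightarrow> shattered A (fiber E e 1 L \<union> fiber E e (-1) L)"
proof -
  have "(\<exists>s\<in>L. \<forall>e\<in>A. s e = a e) \<longleftrightarrow>
      (\<exists>s\<in>fiber E e 1 L \<union> fiber E e (-1) L. \<forall>e\<in>A. s e = a e)" for a
  proof
    assume "\<exists>s\<in>L. \<forall>e\<in>A. s e = a e"
    then obtain s where s: "s \<in> L" "\<forall>e\<in>A. s e = a e" by auto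
    have sm: "s \<in> sign_maps (insert e E)" using s assms by auto
    then have "(restrict s E)(e := s e) = s" by (intro restrict_upd_insert) (auto simp: sign_maps_iff)
    moreover have "restrict s E \<in> sign_maps E" using sign_maps_restrict[OF sm] by auto
    moreover have "s e = 1 \<or> s e = -1" using sm by (auto simp: sign_maps_iff)
    ultimately have "restrict s E \<in> fiber E e 1 L \<union> fiber E e (-1) L"
      using s(1) by (auto simp: fiber_def)
    moreover have "\<forall>e\<in>A. restrict s E e = a e" using s(2) assms(3) by auto
    ultimately show "\<exists>s\<in>fiber E e 1 L \<union> fiber E e (-1) L. \<forall>e\<in>A. s e = a e" by blast
  next
    assume "\<exists>s\<in>fiber E e 1 L \<union> fiber E e (-1) L. \<forall>e\<in>A. s e = a e"
    then obtain s c where "s(e := c) \<in> L" "\<forall>e\<in>A. s e = a e" by (auto simp: fiber_def)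
    then show "\<exists>s\<in>L. \<forall>e\<in>A. s e = a e"
      using assms by (intro bexI[of _ "s(e := c)"]) auto
  qed
  moreover have "A \<subseteq> insert e E" using assms by auto
  ultimately show ?thesis
    using assms fiber_subset[of E e] by (simp add: shattered_iff[of _ "insert e E"] shattered_iff[of _ E])
qed

text \<open>A pattern on \<open>insert e A\<close> prescribes the value at \<open>e\<close>, hence
  the fiber in which its restriction to \<open>A\<close> must be realized.\<close>

lemma shattered_insert_iff:
  assumes "e \<notin> E" "L \<subseteq> sign_maps (insert e E)" "A \<subseteq> E"
  shows "shattered (insert e A) L \<longleftrightarrow> shattered A (fiber E e 1 L) \<and> shattered A (fiber E e (-1) L)"
    (is "?l \<longleftrightarrow> ?r")
proof
  assume ?l
  then have l: "\<forall>a\<in>sign_maps (insert e A). \<exists>s\<in>L. \<forall>e\<in>insert e A. s e = a e"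
    using assms by (subst (asm) shattered_iff[of _ "insert e E"]) auto
  have "shattered A (fiber E e c L)" if c: "c = -1 \<or> c = 1" for c
    unfolding shattered_iff[OF fiber_subset assms(3)]
  proof
    fix a assume a: "a \<in> sign_maps A"
    then obtain s where s: "s \<in> L" "\<forall>f\<in>insert e A. s f = (a(e := c)) f"
      using l sign_maps_upd[OF a c] by blast
    have sm: "s \<in> sign_maps (insert e E)" using s assms by auto
    then have "(restrict s E)(e := s e) = s" by (intro restrict_upd_insert) (auto simp: sign_maps_iff)
    moreover have "restrict s E \<in> sign_maps E" using sign_maps_restrict[OF sm] by auto
    moreover have "s e = c" using s by auto
    ultimately have "restrict s E \<in> fiber E e c L"
      using s(1) by (auto simp: fiber_def)
    moreover have "\<forall>f\<in>A. restrict s E f = a f" using s(2) assms by auto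
    ultimately show "\<exists>s\<in>fiber E e c L. \<forall>e\<in>A. s e = a e" by blast
  qed
  then show ?r by simp
next
  assume r: ?r
  show ?l
  proof (subst shattered_iff[of _ "insert e E"])
    show "\<forall>a\<in>sign_maps (insert e A). \<exists>s\<in>L. \<forall>e\<in>insert e A. s e = a e"
    proof
      fix a assume a: "a \<in> sign_maps (insert e A)"
      then have "a e = -1 \<or> a e = 1" by (auto simp: sign_maps_iff)
      with r have "shattered A (fiber E e (a e) L)" by auto
      then obtain s where "s \<in> fiber E e (a e) L" "\<forall>f\<in>A. s f = restrict a A f"
        using sign_maps_restrict[OF a subset_insertI] unfolding shattered_iff[OF fiber_subset assms(3)]
        by metis
      then show "\<exists>s\<in>L. \<forall>e\<in>insert e A. s e = a e"
        using assms(1) by (intro bexI[of _ "s(e := a e)"]) (auto simp: fiber_def)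
    qed
  qed (use assms in auto)
qed

lemma card_Pow_insert_decomp:
  assumes "finite E" "e \<notin> E" "\<A> \<subseteq> Pow (insert e E)"
  shows "card \<A> = card {A. A \<subseteq> E \<and> A \<in> \<A>} + card {A. A \<subseteq> E \<and> insert e A \<in> \<A>}"
proof -
  let ?X = "{A. A \<subseteq> E \<and> A \<in> \<A>}" and ?Y = "{A. A \<subseteq> E \<and> insert e A \<in> \<A>}"
  have "A \<in> ?X \<union> insert e ` ?Y" if A: "A \<in> \<A>" for A
  proof (cases "e \<in> A")
    case True
    then have "A = insert e (A - {e})" "A - {e} \<in> ?Y"
      using A assms(3) by (auto simp: insert_absorb)
    then show ?thesis by blast
  qed (use A assms(3) in blast)
  then have "\<A> = ?X \<union> insert e ` ?Y" by blast
  moreover have "card (?X \<union> insert e ` ?Y) = card ?X + card (insert e ` ?Y)"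
    using assms by (intro card_Un_disjoint) auto
  moreover have "inj_on (insert e) ?Y"
    using assms(2) by (intro inj_onI) (metis (no_types, lifting) insert_ident mem_Collect_eq subsetD)
  ultimately show ?thesis by (simp add: card_image)
qed

lemma card_shattered_sets_insert:
  assumes "finite E" "e \<notin> E" "L \<subseteq> sign_maps (insert e E)"
  shows "card (shattered_sets (insert e E) L) =
    card (shattered_sets E (fiber E e 1 L \<union> fiber E e (-1) L)) +
    card (shattered_sets E (fiber E e 1 L) \<inter> shattered_sets E (fiber E e (-1) L))"
proof -
  have "{A. A \<subseteq> E \<and> A \<in> shattered_sets (insert e E) L} =
      shattered_sets E (fiber E e 1 L \<union> fiber E e (-1) L)"
    using shattered_Un_fibers_iff[OF assms(2,3)] by (auto simp: shattered_sets_def)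
  moreover have "{A. A \<subseteq> E \<and> insert e A \<in> shattered_sets (insert e E) L} =
      shattered_sets E (fiber E e 1 L) \<inter> shattered_sets E (fiber E e (-1) L)"
    using shattered_insert_iff[OF assms(2,3)] by (auto simp: shattered_sets_def)
  moreover have "shattered_sets (insert e E) L \<subseteq> Pow (insert e E)"
    by (auto simp: shattered_sets_def)
  ultimately show ?thesis using card_Pow_insert_decomp[OF assms(1,2)] by simp
qed

lemma card_shattered_sets_Un_fibers:
  assumes "finite E"
  shows "card (shattered_sets E (fiber E e c L) \<union> shattered_sets E (fiber E e d L)) \<le>
    card (shattered_sets E (fiber E e c L \<union> fiber E e d L))"
proof (rule card_mono[OF finite_shattered_sets[OF assms]])
  have "fiber E e c L \<union> fiber E e d L \<subseteq> sign_maps E" by (simp add: fiber_subset)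
  then show "shattered_sets E (fiber E e c L) \<union> shattered_sets E (fiber E e d L) \<subseteq>
      shattered_sets E (fiber E e c L \<union> fiber E e d L)"
    by (simp add: shattered_sets_mono)
qed

text \<open>Pajor's form of the Sauer-Shelah lemma. A set \<open>A\<close> shattered by both fibers
  is counted twice when the fibers are treated separately, and it accounts for two sets shattered by
  \<open>L\<close>: \<open>A\<close> and \<open>insert e A\<close>.\<close>

lemma card_le_card_shattered_sets:
  assumes "finite E" "L \<subseteq> sign_maps E"
  shows "card L \<le> card (shattered_sets E L)"
  using assms
proof (induction E arbitrary: L rule: finite_induct)
  case empty
  have L: "L = {} \<or> L = {\<lambda>_. undefined}" using empty by (auto simp: sign_maps_def)
  show ?case
  proof (cases "L = {}")
    case False
    then have "shattered_sets {} L = {{}}" using L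
      by (auto simp: shattered_sets_def shattered_def sign_maps_def)
    with False L show ?thesis by simp
  qed simp
next
  case (insert e E)
  let ?P = "fiber E e 1 L" and ?N = "fiber E e (-1) L"
  have "card L = card ?P + card ?N" by (rule card_fibers[OF insert.hyps insert.prems])
  also have "\<dots> \<le> card (shattered_sets E ?P) + card (shattered_sets E ?N)"
    by (intro add_mono insert.IH fiber_subset)
  also have "\<dots> = card (shattered_sets E ?P \<union> shattered_sets E ?N) +
      card (shattered_sets E ?P \<inter> shattered_sets E ?N)"
    by (intro card_Un_Int finite_shattered_sets insert.hyps)
  also have "\<dots> \<le> card (shattered_sets E (?P \<union> ?N)) +
      card (shattered_sets E ?P \<inter> shattered_sets E ?N)"
    by (simp add: card_shattered_sets_Un_fibers insert.hyps)
  also have "\<dots> = card (shattered_sets (insert e E) L)"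
    by (rule card_shattered_sets_insert[OF insert.hyps insert.prems, symmetric])
  finally show ?case .
qed

text \<open>Equality in the chain of \<open>card_le_card_shattered_sets\<close>: together the fibers
  have at least as many elements as shattered sets, and each of them alone has at most as
  many.\<close>

lemma ample_fiber:
  assumes "finite E" "e \<notin> E" "L \<subseteq> sign_maps (insert e E)" "ample (insert e E) L" "c = -1 \<or> c = 1"
  shows "ample E (fiber E e c L)"
proof -
  let ?P = "fiber E e 1 L" and ?N = "fiber E e (-1) L"
  have "card (shattered_sets E ?P) + card (shattered_sets E ?N) = 
     card (shattered_sets E ?P \<union> shattered_sets E ?N) +
      card (shattered_sets E ?P \<inter> shattered_sets E ?N)"
    by (intro card_Un_Int finite_shattered_sets assms)
  also have "\<dots> \<le> card (shattered_sets E (?P \<union> ?N)) +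
      card (shattered_sets E ?P \<inter> shattered_sets E ?N)"
    by (simp add: card_shattered_sets_Un_fibers assms)
  also have "\<dots> = card L"
    using card_shattered_sets_insert[OF assms(1-3)] assms(4) by (simp add: ample_iff)
  also have "\<dots> = card ?P + card ?N" by (rule card_fibers[OF assms(1-3)])
  finally show ?thesis
    using card_le_card_shattered_sets[OF assms(1) fiber_subset, of e 1 L]
      card_le_card_shattered_sets[OF assms(1) fiber_subset, of e "-1" L] assms(5)
    by (auto simp: ample_iff)
qed

text \<open>Now the size of \<open>L\<close> is split as union plus intersection of the fibers.
  Pajor's inequality for the union bounds the number of sets shattered by both fibers by the size of
  the intersection; for the intersection it gives the reverse estimate. The second claim is what
  later produces edges: whatever both fibers shatter is shattered by their common elements.\<close>

lemma ample_Int_fibers: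
  assumes "finite E" "e \<notin> E" "L \<subseteq> sign_maps (insert e E)" "ample (insert e E) L"
  shows "ample E (fiber E e 1 L \<inter> fiber E e (-1) L)"
    and "shattered_sets E (fiber E e 1 L \<inter> fiber E e (-1) L) =
      shattered_sets E (fiber E e 1 L) \<inter> shattered_sets E (fiber E e (-1) L)"
proof -
  let ?P = "fiber E e 1 L" and ?N = "fiber E e (-1) L"
  have PN: "?P \<union> ?N \<subseteq> sign_maps E" "?P \<inter> ?N \<subseteq> sign_maps E" by (auto simp: fiber_def)
  have fin: "finite ?P" "finite ?N"
    by (rule finite_subset[OF fiber_subset finite_sign_maps[OF assms(1)]])+
  have sub: "shattered_sets E (?P \<inter> ?N) \<subseteq> shattered_sets E ?P \<inter> shattered_sets E ?N"
    by (intro Int_greatest shattered_sets_mono[OF _ fiber_subset]) simp_all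
  have "card (?P \<union> ?N) + card (?P \<inter> ?N) = card L"
    by (simp add: card_fibers[OF assms(1-3)] card_Un_Int[OF fin])
  also have "\<dots> = card (shattered_sets E (?P \<union> ?N)) + card (shattered_sets E ?P \<inter> shattered_sets E ?N)"
    using card_shattered_sets_insert[OF assms(1-3)] assms(4) by (simp add: ample_iff)
  finally have *: "card (shattered_sets E ?P \<inter> shattered_sets E ?N) \<le> card (?P \<inter> ?N)"
    using card_le_card_shattered_sets[OF assms(1) PN(1)] by linarith
  have **: "card (?P \<inter> ?N) \<le> card (shattered_sets E (?P \<inter> ?N))"
    using card_le_card_shattered_sets[OF assms(1) PN(2)] .
  show eq: "shattered_sets E (?P \<inter> ?N) = shattered_sets E ?P \<inter> shattered_sets E ?N"
    by (rule card_seteq) (use * ** sub finite_shattered_sets[OF assms(1)] in simp_all)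
  show "ample E (?P \<inter> ?N)"
    using * ** eq by (auto simp: ample_iff)
qed

text \<open>If \<open>\<bar>x e\<bar> < 1\<close>, both values of \<open>c\<close> are admissible;
  with \<open>realization_Int\<close> the restriction then lies over the intersection of the
  fibers.\<close>

lemma realization_restrict:
  assumes "e \<notin> E" "x \<in> realization (insert e E) L" "c = -1 \<or> c = 1" "\<bar>x e\<bar> = 1 \<Longrightarrow> x e = c"
  shows "restrict x E \<in> realization E (fiber E e c L)"
  unfolding realization_iff
proof (intro conjI ballI impI)
  show "restrict x E \<in> cube E"
    using realization_abs_le[OF assms(2)] by (auto simp: cube_iff)
  fix r assume r: "r \<in> sign_maps E" "\<forall>f\<in>E. \<bar>restrict x E f\<bar> = 1 \<longrightarrow> r f = restrict x E f"
  have "r(e := c) \<in> L"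
    by (rule realizationD[OF assms(2) sign_maps_upd[OF r(1) assms(3)]]) (use assms r in auto)
  then show "r \<in> fiber E e c L" using r by (simp add: fiber_def)
qed

lemma realization_upd:
  assumes "e \<notin> E" "L \<subseteq> sign_maps (insert e E)" "z \<in> realization E (fiber E e c L)" "c = -1 \<or> c = 1"
  shows "z(e := c) \<in> realization (insert e E) L"
  unfolding realization_iff
proof (intro conjI ballI impI)
  show "z(e := c) \<in> cube (insert e E)"
    using assms(3,4) by (auto simp: realization_iff cube_iff extensional_def)
  fix r assume r: "r \<in> sign_maps (insert e E)"
    "\<forall>f\<in>insert e E. \<bar>(z(e := c)) f\<bar> = 1 \<longrightarrow> r f = (z(e := c)) f"
  have "r e = c" using r(2) assms(4) by auto
  then have "r = (restrict r E)(e := c)"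
    using restrict_upd_insert[OF sign_maps_extensional[OF r(1)]] by simp
  moreover have "restrict r E \<in> fiber E e c L"
  proof (rule realizationD[OF assms(3) sign_maps_restrict[OF r(1) subset_insertI]])
    fix f assume "f \<in> E" "\<bar>z f\<bar> = 1"
    moreover from this have "f \<noteq> e" using assms(1) by blast
    ultimately show "restrict r E f = z f" using r(2) by simp
  qed
  ultimately show "r \<in> L" by (simp add: fiber_def)
qed

lemma realization_upd_0:
  assumes "e \<notin> E" "L \<subseteq> sign_maps (insert e E)"
    and "z \<in> realization E (fiber E e 1 L \<inter> fiber E e (-1) L)"
  shows "z(e := 0) \<in> realization (insert e E) L"
  unfolding realization_iff
proof (intro conjI ballI impI)
  show "z(e := 0) \<in> cube (insert e E)"
    using assms(3) by (auto simp: realization_iff cube_iff extensional_def)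
  fix r assume r: "r \<in> sign_maps (insert e E)"
    "\<forall>f\<in>insert e E. \<bar>(z(e := 0)) f\<bar> = 1 \<longrightarrow> r f = (z(e := 0)) f"
  have "restrict r E \<in> fiber E e 1 L \<inter> fiber E e (-1) L"
  proof (rule realizationD[OF assms(3) sign_maps_restrict[OF r(1) subset_insertI]])
    fix f assume "f \<in> E" "\<bar>z f\<bar> = 1"
    moreover from this have "f \<noteq> e" using assms(1) by blast
    ultimately show "restrict r E f = z f" using r(2) by simp
  qed
  moreover have "r e = 1 \<or> r e = -1" using r(1) by (auto simp: sign_maps_iff)
  ultimately have "(restrict r E)(e := r e) \<in> L" by (auto simp: fiber_def)
  then show "r \<in> L" using restrict_upd_insert[OF sign_maps_extensional[OF r(1)]] by simp
qed

subsection \<open>The midface property\<close>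

definition parallel :: "'a set \<Rightarrow> ('a \<Rightarrow> real) \<Rightarrow> ('a \<Rightarrow> real) \<Rightarrow> bool" where
  "parallel E x y \<longleftrightarrow> (\<forall>e\<in>E. x e = 0 \<longleftrightarrow> y e = 0)"

text \<open>Coordinates at which \<open>x\<close> and \<open>y\<close> agree are removed one at a
  time, passing to a fiber if the common value is a sign and to the intersection of the fibers if it
  is 0. When no such coordinate is left, parallelism excludes zeros, and the midpoint of any edge of
  \<open>L\<close> is a witness, as it has no common coordinate to respect.\<close>

lemma ample_imp_midface:
  assumes "finite E" "L \<subseteq> sign_maps E" "ample E L"
    and "x \<in> Baryc E L" "y \<in> Baryc E L" "parallel E x y" "x \<noteq> y"
  shows "\<exists>z\<in>realization E L. (\<forall>e\<in>E. x e = y e \<longrightarrow> z e = x e) \<and> (\<exists>e\<in>E. x e \<noteq> y e \<and> z e = 0)"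
  using assms
proof (induction "card E" arbitrary: E L x y)
  case (0 E)
  then have "x \<in> extensional {}" "y \<in> extensional {}"
    using realization_subset_extensional[of E L] by (auto simp: Baryc_iff)
  then have "x = y" by (rule extensionalityI) simp
  with 0 show ?case by simp
next
  case (Suc n E)
  have ext: "x \<in> extensional E" "y \<in> extensional E"
    using Suc.prems realization_subset_extensional by (auto simp: Baryc_iff)
  have lift: ?case if e: "e \<in> E" "x e = y e"
    and K: "K \<subseteq> sign_maps (E - {e})" "ample (E - {e}) K"
      "restrict x (E - {e}) \<in> realization (E - {e}) K" "restrict y (E - {e}) \<in> realization (E - {e}) K"
      "\<And>z. z \<in> realization (E - {e}) K \<Longrightarrow> z(e := x e) \<in> realization E L" for e K
  proof -
    have ne: "restrict x (E - {e}) \<noteq> restrict y (E - {e})"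
    proof
      assume eq: "restrict x (E - {e}) = restrict y (E - {e})"
      have "x = y"
      proof (rule extensionalityI[OF ext])
        fix f assume "f \<in> E" then show "x f = y f"
          using fun_cong[OF eq, of f] e by (cases "f = e") (auto simp: restrict_def)
      qed
      with \<open>x \<noteq> y\<close> show False ..
    qed
    have "n = card (E - {e})" using Suc.hyps e Suc.prems(1) by simp
    from Suc.hyps(1)[OF this, of K "restrict x (E - {e})" "restrict y (E - {e})"]
    obtain z where z: "z \<in> realization (E - {e}) K"
      "\<forall>f\<in>E - {e}. x f = y f \<longrightarrow> z f = x f" "\<exists>f\<in>E - {e}. x f \<noteq> y f \<and> z f = 0"
      using ne K Suc.prems by (auto simp: Baryc_iff parallel_def)
    then show ?case using K(5)[OF z(1)] e(2) by (intro bexI[of _ "z(e := x e)"]) auto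
  qed
  show ?case
  proof (cases "\<exists>e\<in>E. x e = y e")
    case True
    then obtain e where e: "e \<in> E" "x e = y e" by blast
    have E: "insert e (E - {e}) = E" using e by auto
    have L: "L \<subseteq> sign_maps (insert e (E - {e}))" "ample (insert e (E - {e})) L"
      and fin: "finite (E - {e})" and x: "x \<in> realization (insert e (E - {e})) L"
      and y: "y \<in> realization (insert e (E - {e})) L"
      using Suc.prems E by (auto simp: Baryc_iff)
    let ?F = "\<lambda>c. fiber (E - {e}) e c L"
    have xe: "x e = 0 \<or> x e = -1 \<or> x e = 1" using Suc.prems(4) e by (auto simp: Baryc_iff)
    show ?thesis
    proof (cases "x e = 0")
      case True
      have up: "\<And>z. z \<in> realization (E - {e}) (?F 1 \<inter> ?F (-1)) \<Longrightarrow> z(e := x e) \<in> realization E L"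
        using realization_upd_0[OF _ L(1)] E True by auto
      have "restrict w (E - {e}) \<in> realization (E - {e}) (?F 1 \<inter> ?F (-1))" 
        if "w \<in> realization (insert e (E - {e})) L" "w e = 0" for w
        using realization_restrict[OF _ that(1)] that(2) unfolding realization_Int by simp
      moreover have "?F 1 \<inter> ?F (-1) \<subseteq> sign_maps (E - {e})" by (auto simp: fiber_def)
      ultimately show ?thesis
        using lift[OF e, of "?F 1 \<inter> ?F (-1)"] ample_Int_fibers(1)[OF fin _ L] x y True e up by auto
    next
      case False
      then have c: "x e = -1 \<or> x e = 1" using xe by auto
      have "restrict x (E - {e}) \<in> realization (E - {e}) (?F (x e))"
        using realization_restrict[OF _ x c] by simp
      moreover have "restrict y (E - {e}) \<in> realization (E - {e}) (?F (x e))"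
        using realization_restrict[OF _ y c] e by simp
      ultimately show ?thesis
        using lift[OF e fiber_subset ample_fiber[OF fin _ L c]] realization_upd[OF _ L(1) _ c] E
        by auto
    qed
  next
    case False
    then have ne: "\<forall>e\<in>E. x e \<noteq> y e" by blast
    then have x0: "\<forall>e\<in>E. x e \<noteq> 0 \<and> y e \<noteq> 0" using Suc.prems(6) by (auto simp: parallel_def)
    then have xy: "x \<in> sign_maps E" "y \<in> sign_maps E"
      using Suc.prems(4,5) ext by (auto simp: Baryc_iff sign_maps_iff)
    then have xyL: "x \<in> L" "y \<in> L"
      using Suc.prems(4,5) sign_maps_Int_realization[of E L] by (auto simp: Baryc_iff)
    obtain e where e: "e \<in> E" using Suc.hyps by fastforce
    let ?E = "E - {e}"
    have E: "insert e ?E = E" using e by auto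
    have fin: "finite ?E" and eE: "e \<notin> ?E"
      and L: "L \<subseteq> sign_maps (insert e ?E)" "ample (insert e ?E) L"
      using Suc.prems E by auto
    \<comment> \<open>\<open>x\<close> and \<open>y\<close> are opposite vertices in
      \<open>L\<close>, so both fibers over \<open>e\<close> are nonempty, that is, they shatter the
      empty set. By \<open>ample_Int_fibers\<close> their intersection shatters it too, and any
      element of the intersection is an edge in direction \<open>e\<close>.\<close>
    have "shattered {e} L"
    proof (subst shattered_iff[OF Suc.prems(2)])
      show "\<forall>a\<in>sign_maps {e}. \<exists>s\<in>L. \<forall>e\<in>{e}. s e = a e"
      proof
        fix a :: "'a \<Rightarrow> real" assume "a \<in> sign_maps {e}"
        then have "a e = x e \<or> a e = y e"
          using xy ne e unfolding sign_maps_iff by (metis insertI1)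
        then show "\<exists>s\<in>L. \<forall>e\<in>{e}. s e = a e" using xyL by auto
      qed
    qed (use e in auto)
    then have "{} \<in> shattered_sets ?E (fiber ?E e 1 L) \<inter> shattered_sets ?E (fiber ?E e (-1) L)"
      using shattered_insert_iff[OF eE L(1), of "{}"] by (simp add: shattered_sets_def)
    then have "shattered {} (fiber ?E e 1 L \<inter> fiber ?E e (-1) L)"
      unfolding ample_Int_fibers(2)[OF fin eE L, symmetric] by (simp add: shattered_sets_def)
    then have "fiber ?E e 1 L \<inter> fiber ?E e (-1) L \<noteq> {}"
      by (auto simp: shattered_def sign_maps_def)
    then obtain u where "u \<in> fiber ?E e 1 L \<inter> fiber ?E e (-1) L" by blast
    then have "u \<in> realization ?E (fiber ?E e 1 L \<inter> fiber ?E e (-1) L)"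
      using sign_maps_Int_realization[of ?E "fiber ?E e 1 L \<inter> fiber ?E e (-1) L"] fiber_subset[of ?E e 1 L]
      by blast
    then have "u(e := 0) \<in> realization E L"
      using realization_upd_0[OF eE L(1)] E by auto
    then show ?thesis using e ne by (intro bexI[of _ "u(e := 0)"]) auto
  qed
qed

text \<open>The second alternative, a point \<open>z\<close> in a further face of the same direction, is needed since
  weak convexity may produce the barycenter of a parallel face between those of \<open>x\<close> and \<open>y\<close>.\<close>

definition midface_property :: "'a set \<Rightarrow> ('a \<Rightarrow> real) set \<Rightarrow> bool" where
  "midface_property E L \<longleftrightarrow>
    (\<forall>x\<in>Baryc E L. \<forall>y\<in>Baryc E L. parallel E x y \<longrightarrow> x \<noteq> y \<longrightarrow>
      (\<exists>z\<in>realization E L. (\<forall>e\<in>E. x e = y e \<longrightarrow> z e = x e \<or> \<bar>z e\<bar> < 1) \<and>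
        ((\<exists>e\<in>E. x e \<noteq> y e \<and> \<bar>z e\<bar> < 1) \<or>
         (\<exists>e\<in>E. \<bar>z e\<bar> = 1 \<and> z e \<noteq> x e) \<and> (\<exists>e\<in>E. \<bar>z e\<bar> = 1 \<and> z e \<noteq> y e))))"

lemma midface_propertyD:
  assumes "midface_property E L" "x \<in> Baryc E L" "y \<in> Baryc E L" "parallel E x y" "x \<noteq> y"
  obtains z where "z \<in> realization E L" "\<forall>e\<in>E. x e = y e \<longrightarrow> z e = x e \<or> \<bar>z e\<bar> < 1"
    "(\<exists>e\<in>E. x e \<noteq> y e \<and> \<bar>z e\<bar> < 1) \<or>
      (\<exists>e\<in>E. \<bar>z e\<bar> = 1 \<and> z e \<noteq> x e) \<and> (\<exists>e\<in>E. \<bar>z e\<bar> = 1 \<and> z e \<noteq> y e)"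
  using assms unfolding midface_property_def by blast

lemma midface_propertyI:
  assumes "\<And>x y. x \<in> Baryc E L \<Longrightarrow> y \<in> Baryc E L \<Longrightarrow> parallel E x y \<Longrightarrow> x \<noteq> y \<Longrightarrow>
    \<exists>z\<in>realization E L. (\<forall>e\<in>E. x e = y e \<longrightarrow> z e = x e \<or> \<bar>z e\<bar> < 1) \<and>
        (\<exists>e\<in>E. x e \<noteq> y e \<and> \<bar>z e\<bar> < 1)"
  shows "midface_property E L"
  using assms unfolding midface_property_def by (metis (no_types, lifting))

lemma ample_imp_midface_property:
  assumes "finite E" "L \<subseteq> sign_maps E" "ample E L"
  shows "midface_property E L"
proof (rule midface_propertyI)
  fix x y assume "x \<in> Baryc E L" "y \<in> Baryc E L" "parallel E x y" "x \<noteq> y"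
  from ample_imp_midface[OF assms this]
  obtain z e where "z \<in> realization E L" "\<forall>e\<in>E. x e = y e \<longrightarrow> z e = x e" "e \<in> E" "x e \<noteq> y e" "z e = 0"
    by auto
  then show "\<exists>z\<in>realization E L. (\<forall>e\<in>E. x e = y e \<longrightarrow> z e = x e \<or> \<bar>z e\<bar> < 1) \<and>
        (\<exists>e\<in>E. x e \<noteq> y e \<and> \<bar>z e\<bar> < 1)"
    by (intro bexI[of _ z] conjI bexI[of _ e]) auto
qed

lemma Baryc_cases:
  assumes "x \<in> Baryc E L" "e \<in> E"
  obtains "x e = -1" | "x e = 0" | "x e = 1"
  using assms by (auto simp: Baryc_iff)

text \<open>The witness \<open>z\<close> is turned into a barycenter \<open>u\<close> parallel to
  \<open>x\<close>. Either \<open>u\<close> is \<open>x\<close>, and \<open>z\<close> itself shows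
  which coordinate can be flipped, or \<open>u\<close> is closer to \<open>x\<close> than
  \<open>y\<close> is, and every flip of \<open>x\<close> towards \<open>u\<close> is also one
  towards \<open>y\<close>.\<close>

lemma midface_property_imp_flip:
  assumes "finite E" "midface_property E L"
    and "x \<in> Baryc E L" "y \<in> Baryc E L" "parallel E x y" "x \<noteq> y"
  shows "\<exists>e\<in>E. x e \<noteq> y e \<and> x(e := y e) \<in> realization E L"
  using assms(4-6)
proof (induction "card {e\<in>E. x e \<noteq> y e}" arbitrary: y rule: less_induct)
  case less
  obtain z where z: "z \<in> realization E L" "\<forall>e\<in>E. x e = y e \<longrightarrow> z e = x e \<or> \<bar>z e\<bar> < 1"
    "(\<exists>e\<in>E. x e \<noteq> y e \<and> \<bar>z e\<bar> < 1) \<or>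
      (\<exists>e\<in>E. \<bar>z e\<bar> = 1 \<and> z e \<noteq> x e) \<and> (\<exists>e\<in>E. \<bar>z e\<bar> = 1 \<and> z e \<noteq> y e)"
    using midface_propertyD[OF assms(2,3) less.prems] by blast
  have par: "x e = 0 \<longleftrightarrow> y e = 0" if "e \<in> E" for e
    using less.prems(2) that by (auto simp: parallel_def)
  have xext: "x \<in> extensional E" and xr: "x \<in> realization E L"
    using assms(3) realization_subset_extensional by (auto simp: Baryc_iff)
  have z0: "\<bar>z e\<bar> < 1" if "e \<in> E" "x e = 0" for e using z(2) par[of e] that by fastforce
  \<comment> \<open>Interior coordinates of \<open>z\<close> are reset to \<open>x\<close>. The
    coordinates of \<open>z\<close> equal to 1 or -1 survive, which keeps \<open>u\<close> in |L|;
    and \<open>z\<close> is interior wherever \<open>x\<close> vanishes, which makes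
    \<open>u\<close> parallel to \<open>x\<close>.\<close>
  define u where "u = (\<lambda>e\<in>E. if \<bar>z e\<bar> < 1 then x e else z e)"
  have zle: "\<bar>z e\<bar> \<le> 1" if "e \<in> E" for e using realization_abs_le[OF z(1) that] .
  have u01: "u e \<in> {-1, 0, 1}" if "e \<in> E" for e
    using zle[OF that] assms(3) that by (auto simp: u_def Baryc_iff abs_if split: if_splits)
  have ur: "u \<in> realization E L"
    unfolding realization_iff
  proof (intro conjI ballI impI)
    show "u \<in> cube E" using u01 by (fastforce simp: cube_iff u_def)
    fix r assume r: "r \<in> sign_maps E" "\<forall>e\<in>E. \<bar>u e\<bar> = 1 \<longrightarrow> r e = u e"
    show "r \<in> L" by (rule realizationD[OF z(1) r(1)]) (use r(2) in \<open>auto simp: u_def\<close>)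
  qed
  have uB: "u \<in> Baryc E L" using ur u01 by (simp add: Baryc_iff)
  have upar: "parallel E x u" using z0 zle by (fastforce simp: parallel_def u_def)
  show ?case
  proof (cases "u = x")
    case True
    \<comment> \<open>With \<open>u = x\<close> all sign coordinates of \<open>z\<close> agree with
      \<open>x\<close>, so the second alternative fails and \<open>z\<close> is interior at some
      \<open>e\<close> where \<open>x\<close> and \<open>y\<close> differ. The smallest face through
      \<open>z\<close> then contains \<open>x(e := y e)\<close>.\<close>
    have "\<not> (\<exists>e\<in>E. \<bar>z e\<bar> = 1 \<and> z e \<noteq> x e)"
    proof
      assume "\<exists>e\<in>E. \<bar>z e\<bar> = 1 \<and> z e \<noteq> x e"
      then obtain e where "e \<in> E" "\<bar>z e\<bar> = 1" "z e \<noteq> x e" by blast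
      then show False using fun_cong[OF True, of e] by (auto simp: u_def)
    qed
    then obtain e where e: "e \<in> E" "x e \<noteq> y e" "\<bar>z e\<bar> < 1" using z(3) by blast
    have "x(e := y e) \<in> realization E L"
      unfolding realization_iff
    proof (intro conjI ballI impI)
      have "\<bar>y e\<bar> \<le> 1" using less.prems(1) e realization_abs_le[of y E L] by (auto simp: Baryc_iff)
      then show "x(e := y e) \<in> cube E"
        using xr e xext by (auto simp: cube_iff realization_iff extensional_def)
      fix r assume r: "r \<in> sign_maps E" "\<forall>f\<in>E. \<bar>(x(e := y e)) f\<bar> = 1 \<longrightarrow> r f = (x(e := y e)) f"
      show "r \<in> L"
      proof (rule realizationD[OF z(1) r(1)])
        fix f assume f: "f \<in> E" "\<bar>z f\<bar> = 1"
        then have "x f = z f" using fun_cong[OF True, of f] by (auto simp: u_def)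
        moreover have "f \<noteq> e" using f e by auto
        ultimately show "r f = z f" using r(2) f by auto
      qed
    qed
    then show ?thesis using e by blast
  next
    case False
    have sub: "x e \<noteq> y e" if "e \<in> E" "x e \<noteq> u e" for e
      using z(2) that by (auto simp: u_def split: if_splits)
    \<comment> \<open>A difference between \<open>x\<close> and \<open>y\<close> that is absent
      between \<open>x\<close> and \<open>u\<close>; it makes the induction measure drop
      strictly.\<close>
    obtain e where e: "e \<in> E" "x e \<noteq> y e" "u e = x e"
    proof -
      consider e where "e \<in> E" "x e \<noteq> y e" "\<bar>z e\<bar> < 1" | e where "e \<in> E" "\<bar>z e\<bar> = 1" "z e \<noteq> y e"
        using z(3) by blast
      then show ?thesis
      proof cases
        case 1 then show ?thesis using that by (auto simp: u_def)
      next
        case 2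
        have ne: "x e \<noteq> y e" using z(2) 2 by force
        then have "x e \<noteq> 0" "y e \<noteq> 0" using par 2(1) by auto
        then have "z e = x e"
          using 2 ne Baryc_cases[OF assms(3) 2(1)] Baryc_cases[OF less.prems(1) 2(1)]
          by (metis abs_eq_iff' abs_minus_cancel)
        then show ?thesis using 2 ne that by (auto simp: u_def)
      qed
    qed
    have "card {e\<in>E. x e \<noteq> u e} < card {e\<in>E. x e \<noteq> y e}"
    proof (rule psubset_card_mono)
      have "e \<in> {e\<in>E. x e \<noteq> y e} - {e\<in>E. x e \<noteq> u e}" using e by simp
      then show "{e\<in>E. x e \<noteq> u e} \<subset> {e\<in>E. x e \<noteq> y e}" using sub by blast
    qed (use assms(1) in simp)
    from less.hyps[OF this uB upar] False obtain f
      where f: "f \<in> E" "x f \<noteq> u f" "x(f := u f) \<in> realization E L" by auto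
    have ne: "x f \<noteq> y f" using sub f by blast
    then have "x f \<noteq> 0" "y f \<noteq> 0" using par f(1) by auto
    moreover have "u f \<noteq> 0" using upar f(1) \<open>x f \<noteq> 0\<close> by (auto simp: parallel_def)
    ultimately have "u f = y f"
      using ne f(2) Baryc_cases[OF assms(3) f(1)] Baryc_cases[OF less.prems(1) f(1)] u01[OF f(1)]
      by (metis empty_iff insert_iff)
    then show ?thesis using f ne by auto
  qed
qed

text \<open>If the value at a differing coordinate is interior for one of the two points, that point
  moves freely along this axis inside its smallest face. Otherwise all differences are between
  opposite signs, and the flip lemma applies to the barycenters of the smallest faces. The move is
  found at one of the two ends, hence the disjunction.\<close>

lemma midface_property_imp_axis_step:
  assumes "finite E" "midface_property E L" "x \<in> realization E L" "y \<in> realization E L" "x \<noteq> y"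
  shows "\<exists>e\<in>E. x e \<noteq> y e \<and>
    ((\<forall>c. \<bar>c\<bar> \<le> 1 \<longrightarrow> x(e := c) \<in> realization E L) \<or> (\<forall>c. \<bar>c\<bar> \<le> 1 \<longrightarrow> y(e := c) \<in> realization E L))"
proof -
  have ext: "x \<in> extensional E" "y \<in> extensional E"
    using assms(3,4) realization_subset_extensional by auto
  have free: "w(e := c) \<in> realization E L"
    if w: "w \<in> realization E L" "e \<in> E" "\<bar>w e\<bar> < 1" "\<bar>c\<bar> \<le> 1" for w e and c :: real
    unfolding realization_iff
  proof (intro conjI ballI impI)
    show "w(e := c) \<in> cube E" using w by (auto simp: realization_iff cube_iff extensional_def)
    fix r assume r: "r \<in> sign_maps E" "\<forall>f\<in>E. \<bar>(w(e := c)) f\<bar> = 1 \<longrightarrow> r f = (w(e := c)) f"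
    show "r \<in> L" 
    proof (rule realizationD[OF w(1) r(1)])
      fix f assume "f \<in> E" "\<bar>w f\<bar> = 1" 
      then show "r f = w f" using r(2) w(3) by (cases "f = e") auto
    qed
  qed
  show ?thesis
  proof (cases "\<exists>e\<in>E. x e \<noteq> y e \<and> (\<bar>x e\<bar> < 1 \<or> \<bar>y e\<bar> < 1)")
    case True
    then obtain e where e: "e \<in> E" "x e \<noteq> y e" "\<bar>x e\<bar> < 1 \<or> \<bar>y e\<bar> < 1" by blast
    then show ?thesis using free[OF assms(3) e(1)] free[OF assms(4) e(1)] by blast
  next
    case False
    have one: "\<bar>x e\<bar> = 1 \<and> \<bar>y e\<bar> = 1" if "e \<in> E" "x e \<noteq> y e" for e
      using False that realization_abs_le[OF assms(3) that(1)] realization_abs_le[OF assms(4) that(1)]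
      by fastforce
    \<comment> \<open>\<open>b w\<close> is the barycenter of the smallest face through
      \<open>w\<close>. Off the differing coordinates \<open>x\<close> and \<open>y\<close>
      coincide, and on them both are signs, so \<open>b x\<close> and \<open>b y\<close> are
      parallel.\<close>
    define b where "b w = (\<lambda>e\<in>E. if \<bar>w e\<bar> = 1 then w e else 0)" for w :: "'a \<Rightarrow> real"
    have bB: "b w \<in> Baryc E L" if w: "w \<in> realization E L" for w
      unfolding Baryc_iff realization_iff
    proof (intro conjI ballI impI)
      show "b w \<in> cube E" by (auto simp: b_def cube_iff)
      show "b w e \<in> {-1, 0, 1}" if "e \<in> E" for e using that by (auto simp: b_def abs_if split: if_splits)
      fix r assume r: "r \<in> sign_maps E" "\<forall>e\<in>E. \<bar>b w e\<bar> = 1 \<longrightarrow> r e = b w e"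
      show "r \<in> L" by (rule realizationD[OF w r(1)]) (use r(2) in \<open>auto simp: b_def\<close>)
    qed
    have "parallel E (b x) (b y)" unfolding parallel_def
    proof
      fix e assume "e \<in> E" then show "b x e = 0 \<longleftrightarrow> b y e = 0"
        using one[of e] by (cases "x e = y e") (auto simp: b_def)
    qed
    moreover have "b x \<noteq> b y"
    proof -
      obtain e where e: "e \<in> E" "x e \<noteq> y e" using \<open>x \<noteq> y\<close> extensionalityI[OF ext] by blast
      then show ?thesis using one[OF e] by (auto simp: b_def dest!: fun_cong[of _ _ e])
    qed
    ultimately obtain e where e: "e \<in> E" "b x e \<noteq> b y e" "(b x)(e := b y e) \<in> realization E L"
      using midface_property_imp_flip[OF assms(1,2) bB[OF assms(3)] bB[OF assms(4)]] by blast
    have ne: "x e \<noteq> y e"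
    proof
      assume "x e = y e"
      then have "b x e = b y e" by (simp only: b_def restrict_def)
      with e(2) show False ..
    qed
    have o: "\<bar>x e\<bar> = 1" "\<bar>y e\<bar> = 1" using one[OF e(1) ne] by auto
    \<comment> \<open>The smallest face through \<open>x\<close> and its mirror image in direction
      \<open>e\<close> both lie in |L|, hence so does the prism spanned by them.\<close>
    have "x(e := c) \<in> realization E L" if "\<bar>c\<bar> \<le> 1" for c
      unfolding realization_iff
    proof (intro conjI ballI impI)
      show "x(e := c) \<in> cube E"
        using assms(3) that e(1) by (auto simp: realization_iff cube_iff extensional_def)
      fix r assume r: "r \<in> sign_maps E" "\<forall>f\<in>E. \<bar>(x(e := c)) f\<bar> = 1 \<longrightarrow> r f = (x(e := c)) f"
      have "r e = x e \<or> r e = y e" using ne o r(1) e(1) by (auto simp: sign_maps_iff abs_if split: if_splits)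
      then show "r \<in> L"
      proof
        assume *: "r e = x e"
        show "r \<in> L"
        proof (rule realizationD[OF assms(3) r(1)])
          fix f assume "f \<in> E" "\<bar>x f\<bar> = 1" then show "r f = x f" using r(2) * by (cases "f = e") auto
        qed
      next
        assume *: "r e = y e"
        show "r \<in> L"
        proof (rule realizationD[OF e(3) r(1)])
          fix f assume "f \<in> E" "\<bar>((b x)(e := b y e)) f\<bar> = 1"
          then show "r f = ((b x)(e := b y e)) f" using r(2) * o
            by (cases "f = e") (auto simp: b_def split: if_splits)
        qed
      qed
    qed
    then show ?thesis using e(1) ne by blast
  qed
qed

section \<open>Coordinatewise estimates for the l1-metric\<close>

lemma l1_dist_nonneg: "0 \<le> l1_dist E x y"
  by (simp add: l1_dist_def sum_nonneg)

lemma l1_dist_eq_0: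
  assumes "finite E" "x \<in> extensional E" "y \<in> extensional E" "l1_dist E x y = 0"
  shows "x = y"
  using assms by (intro extensionalityI[OF assms(2,3)]) (simp add: l1_dist_def sum_nonneg_eq_0_iff)

lemma abs_le_l1_dist: "finite E \<Longrightarrow> e \<in> E \<Longrightarrow> \<bar>x e - y e\<bar> \<le> l1_dist E x y"
  unfolding l1_dist_def by (rule member_le_sum) auto

lemma l1_dist_between_iff:
  assumes "finite E"
  shows "l1_dist E x y = l1_dist E x z + l1_dist E z y \<longleftrightarrow>
    (\<forall>e\<in>E. \<bar>x e - y e\<bar> = \<bar>x e - z e\<bar> + \<bar>z e - y e\<bar>)"
proof -
  have "l1_dist E x y = l1_dist E x z + l1_dist E z y \<longleftrightarrow>
    (\<Sum>e\<in>E. (\<bar>x e - z e\<bar> + \<bar>z e - y e\<bar>) - \<bar>x e - y e\<bar>) = 0"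
    by (auto simp: l1_dist_def sum.distrib sum_subtractf)
  also have "\<dots> \<longleftrightarrow> (\<forall>e\<in>E. (\<bar>x e - z e\<bar> + \<bar>z e - y e\<bar>) - \<bar>x e - y e\<bar> = 0)"
    by (rule sum_nonneg_eq_0_iff[OF assms]) linarith
  finally show ?thesis by auto
qed

lemma l1_dist_sign_maps:
  assumes "finite E" "s \<in> sign_maps E" "t \<in> sign_maps E"
  shows "l1_dist E s t = 2 * real (card {e\<in>E. s e \<noteq> t e})"
proof -
  have "\<bar>s e - t e\<bar> = (if s e \<noteq> t e then 2 else 0)" if "e \<in> E" for e
    using assms(2,3) that unfolding sign_maps_iff by fastforce
  then have "l1_dist E s t = (\<Sum>e\<in>E. if s e \<noteq> t e then 2 else 0)"
    by (simp add: l1_dist_def)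
  also have "\<dots> = (\<Sum>e\<in>{e\<in>E. s e \<noteq> t e}. 2)"
    using assms(1) by (intro sum.mono_neutral_cong_right) auto
  finally show ?thesis by simp
qed

subsection \<open>Staircase paths\<close>

definition ramp :: "real \<Rightarrow> real" where
  "ramp u = max 0 (min 1 u)"

lemma ramp_bounds: "0 \<le> ramp u" "ramp u \<le> 1"
  by (auto simp: ramp_def)

lemma ramp_mono: "u \<le> v \<Longrightarrow> ramp u \<le> ramp v"
  by (auto simp: ramp_def)

lemma ramp_0: "u \<le> 0 \<Longrightarrow> ramp u = 0"
  by (auto simp: ramp_def)

lemma ramp_1: "1 \<le> u \<Longrightarrow> ramp u = 1"
  by (auto simp: ramp_def)

text \<open>The coordinate \<open>e\<close> moves during the time interval \<open>[\<tau> e, \<tau> e + 1]\<close>.\<close>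

definition staircase :: "'a set \<Rightarrow> ('a \<Rightarrow> real) \<Rightarrow> ('a \<Rightarrow> real) \<Rightarrow> ('a \<Rightarrow> real) \<Rightarrow> real \<Rightarrow> 'a \<Rightarrow> real" where
  "staircase E x y \<tau> t = (\<lambda>e\<in>E. x e + ramp (t - \<tau> e) * (y e - x e))"

text \<open>Time runs over the whole real line with arbitrary starting times, so that prepending a
  piece amounts to choosing an earlier time and nothing has to be rescaled. Moves of different
  coordinates may overlap.\<close>

definition stair_joined :: "'a set \<Rightarrow> ('a \<Rightarrow> real) set \<Rightarrow> ('a \<Rightarrow> real) \<Rightarrow> ('a \<Rightarrow> real) \<Rightarrow> bool" where
  "stair_joined E L x y \<longleftrightarrow> (\<exists>\<tau>. \<forall>t. staircase E x y \<tau> t \<in> realization E L)"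

lemma stair_joined_refl:
  assumes "x \<in> realization E L"
  shows "stair_joined E L x x"
proof -
  have "x \<in> extensional E" using assms realization_subset_extensional by blast
  then have "staircase E x x \<tau> t = x" for \<tau> t
    by (auto simp: staircase_def extensional_def restrict_def fun_eq_iff)
  then show ?thesis using assms by (simp add: stair_joined_def)
qed

lemma stair_joined_sym:
  assumes "stair_joined E L x y"
  shows "stair_joined E L y x"
proof -
  obtain \<tau> where \<tau>: "\<And>t. staircase E x y \<tau> t \<in> realization E L"
    using assms by (auto simp: stair_joined_def)
  \<comment> \<open>Reversing time maps the interval from \<open>\<tau> e\<close> to
    \<open>\<tau> e + 1\<close> to the one that starts at \<open>- \<tau> e - 1\<close>.\<close>
  have "staircase E y x (\<lambda>e. - \<tau> e - 1) t = staircase E x y \<tau> (- t)" for t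
  proof -
    have *: "ramp (t - (- \<tau> e - 1)) = 1 - ramp (- t - \<tau> e)" for e
      by (auto simp: ramp_def)
    show ?thesis unfolding staircase_def by (rule restrict_ext) (simp only: *, algebra)
  qed
  then show ?thesis unfolding stair_joined_def using \<tau> by metis
qed

text \<open>The premise \<open>cases\<close> says that no coordinate moves both on the segment from
  \<open>x\<close> to \<open>w\<close> and afterwards. The combined path therefore still moves each
  coordinate at most once, directly from \<open>x e\<close> to \<open>y e\<close>.\<close>

lemma stair_joined_prepend:
  assumes "finite E" "stair_joined E L w y"
    and cases: "\<And>e. e \<in> E \<Longrightarrow> x e = w e \<or> w e = y e"
    and seg: "\<And>c. 0 \<le> c \<Longrightarrow> c \<le> 1 \<Longrightarrow> (\<lambda>e\<in>E. x e + c * (w e - x e)) \<in> realization E L"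
  shows "stair_joined E L x y"
proof -
  obtain \<tau> where \<tau>: "\<And>t. staircase E w y \<tau> t \<in> realization E L"
    using assms by (auto simp: stair_joined_def)
  \<comment> \<open>No move of the given staircase starts before \<open>m + 1\<close>, which leaves
    the time from \<open>m\<close> to \<open>m + 1\<close> for the segment. The inserted 0 keeps the
    minimum meaningful when \<open>E\<close> is empty.\<close>
  define m where "m = Min (insert 0 (\<tau> ` E)) - 1"
  have m: "m + 1 \<le> \<tau> e" if "e \<in> E" for e
    using assms(1) that by (simp add: m_def)
  define \<sigma> where "\<sigma> e = (if x e = w e then \<tau> e else m)" for e
  have "staircase E x y \<sigma> t \<in> realization E L" for t
  proof (cases "t \<le> m + 1")
    case True
    have "staircase E x y \<sigma> t = (\<lambda>e\<in>E. x e + ramp (t - m) * (w e - x e))"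
      unfolding staircase_def
    proof (rule restrict_ext)
      fix e assume e: "e \<in> E"
      then have "ramp (t - \<tau> e) = 0" using m[OF e] True by (intro ramp_0) simp
      then show "x e + ramp (t - \<sigma> e) * (y e - x e) = x e + ramp (t - m) * (w e - x e)"
        using cases[OF e] by (auto simp: \<sigma>_def)
    qed
    then show ?thesis using seg ramp_bounds by simp
  next
    case False
    have "staircase E x y \<sigma> t = staircase E w y \<tau> t"
      unfolding staircase_def
    proof (rule restrict_ext)
      fix e assume e: "e \<in> E"
      have "ramp (t - m) = 1" using False by (intro ramp_1) simp
      then show "x e + ramp (t - \<sigma> e) * (y e - x e) = w e + ramp (t - \<tau> e) * (y e - w e)"
        using cases[OF e] by (auto simp: \<sigma>_def)
    qed
    then show ?thesis using \<tau> by simp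
  qed
  then show ?thesis unfolding stair_joined_def by blast
qed

text \<open>\<open>X\<close> is all of |L| under the midface property, and only the vertex set
  \<open>L\<close> when isometry is the hypothesis. A move at the end \<open>y\<close> is handled by
  reversing the path; either kind of move removes one differing coordinate.\<close>

lemma stair_joined_if_axis_steps:
  assumes "finite E" "X \<subseteq> realization E L" "x \<in> X" "y \<in> X"
    and step: "\<And>x y. x \<in> X \<Longrightarrow> y \<in> X \<Longrightarrow> x \<noteq> y \<Longrightarrow> \<exists>e\<in>E. x e \<noteq> y e \<and>
      (x(e := y e) \<in> X \<and> (\<forall>c. \<bar>c\<bar> \<le> 1 \<longrightarrow> x(e := c) \<in> realization E L) \<or>
       y(e := x e) \<in> X \<and> (\<forall>c. \<bar>c\<bar> \<le> 1 \<longrightarrow> y(e := c) \<in> realization E L))"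
  shows "stair_joined E L x y"
  using assms(3,4)
proof (induction "card {e\<in>E. x e \<noteq> y e}" arbitrary: x y rule: less_induct)
  case less
  have move: "stair_joined E L x y"
    if "x \<in> X" "y \<in> X" "e \<in> E" "x e \<noteq> y e" "\<forall>c. \<bar>c\<bar> \<le> 1 \<longrightarrow> x(e := c) \<in> realization E L"
       "stair_joined E L (x(e := y e)) y" for x y e
  proof (rule stair_joined_prepend[OF assms(1) that(6)])
    show "x f = (x(e := y e)) f \<or> (x(e := y e)) f = y f" for f by simp
    fix c :: real assume c: "0 \<le> c" "c \<le> 1"
    have "\<bar>x e\<bar> \<le> 1" "\<bar>y e\<bar> \<le> 1"
      using realization_abs_le[OF subsetD[OF assms(2)]] that(1-3) by auto
    then have "x e \<in> {-1..1}" "y e \<in> {-1..1}" by auto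
    then have "(1 - c) *\<^sub>R x e + c *\<^sub>R y e \<in> {-1..1}"
      using c by (intro convexD_alt) auto
    then have "\<bar>x e + c * (y e - x e)\<bar> \<le> 1" by (simp add: algebra_simps abs_le_iff)
    moreover have "(\<lambda>f\<in>E. x f + c * ((x(e := y e)) f - x f)) = x(e := x e + c * (y e - x e))"
      using \<open>e \<in> E\<close> \<open>x \<in> X\<close> assms(2) realization_subset_extensional[of E L]
      by (auto simp: restrict_def extensional_def fun_eq_iff)
    ultimately show "(\<lambda>f\<in>E. x f + c * ((x(e := y e)) f - x f)) \<in> realization E L"
      using that(5) by simp
  qed
  have smaller: "card {f\<in>E. (x(e := y e)) f \<noteq> y f} < card {f\<in>E. x f \<noteq> y f}"
    if "e \<in> E" "x e \<noteq> y e" for e and x y :: "'a \<Rightarrow> real"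
    using that assms(1) by (intro psubset_card_mono) auto
  show ?case
  proof (cases "x = y")
    case True
    then show ?thesis using less.prems assms(2) stair_joined_refl by auto
  next
    case False
    then obtain e where e: "e \<in> E" "x e \<noteq> y e" and
      alt: "x(e := y e) \<in> X \<and> (\<forall>c. \<bar>c\<bar> \<le> 1 \<longrightarrow> x(e := c) \<in> realization E L) \<or>
       y(e := x e) \<in> X \<and> (\<forall>c. \<bar>c\<bar> \<le> 1 \<longrightarrow> y(e := c) \<in> realization E L)"
      using step[OF less.prems] by blast
    from alt show ?thesis
    proof
      assume *: "x(e := y e) \<in> X \<and> (\<forall>c. \<bar>c\<bar> \<le> 1 \<longrightarrow> x(e := c) \<in> realization E L)"
      then have "stair_joined E L (x(e := y e)) y"
        using less.hyps[OF smaller[of e x y, OF e]] less.prems by blast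
      then show ?thesis using move[of x y e] less.prems e * by blast
    next
      assume *: "y(e := x e) \<in> X \<and> (\<forall>c. \<bar>c\<bar> \<le> 1 \<longrightarrow> y(e := c) \<in> realization E L)"
      have "card {f\<in>E. x f \<noteq> (y(e := x e)) f} < card {f\<in>E. x f \<noteq> y f}"
        using smaller[of e y x] e by (simp add: eq_commute)
      then have "stair_joined E L x (y(e := x e))"
        using less.hyps less.prems * by blast
      then have "stair_joined E L y x"
        using move[of y x e] less.prems e * stair_joined_sym by metis
      then show ?thesis by (rule stair_joined_sym)
    qed
  qed
qed

lemma midface_property_imp_stair_joined:
  assumes "finite E" "midface_property E L" "x \<in> realization E L" "y \<in> realization E L"
  shows "stair_joined E L x y"
proof (rule stair_joined_if_axis_steps[OF assms(1) subset_refl assms(3,4)])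
  fix x y assume xy: "x \<in> realization E L" "y \<in> realization E L" "x \<noteq> y"
  show "\<exists>e\<in>E. x e \<noteq> y e \<and>
      (x(e := y e) \<in> realization E L \<and> (\<forall>c. \<bar>c\<bar> \<le> 1 \<longrightarrow> x(e := c) \<in> realization E L) \<or>
       y(e := x e) \<in> realization E L \<and> (\<forall>c. \<bar>c\<bar> \<le> 1 \<longrightarrow> y(e := c) \<in> realization E L))"
    using midface_property_imp_axis_step[OF assms(1,2) xy] realization_abs_le[OF xy(1)] realization_abs_le[OF xy(2)]
    by blast
qed

section \<open>Curves in the cubihedron and their lengths\<close>

lemma continuous_map_realization_iff:
  assumes "finite E" "K \<subseteq> extensional E"
  shows "continuous_map (top_of_set {0..1::real}) (Metric_space.mtopology K (l1_dist E)) \<gamma> \<longleftrightarrow>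
    \<gamma> ` {0..1} \<subseteq> K \<and> (\<forall>e\<in>E. continuous_on {0..1} (\<lambda>t. \<gamma> t e))" (is "?l \<longleftrightarrow> ?r")
proof -
  interpret Metric_space K "l1_dist E" by (rule Metric_space_l1_dist[OF assms])
  show ?thesis
  proof
    assume l: ?l
    then have "\<gamma> ` {0..1} \<subseteq> K" using continuous_map_image_subset_topspace by fastforce
    moreover have "continuous_on {0..1} (\<lambda>t. \<gamma> t e)" if e: "e \<in> E" for e
      unfolding continuous_on_iff
    proof (intro ballI allI impI)
      fix t \<epsilon> :: real assume t: "t \<in> {0..1}" and eps: "0 < \<epsilon>"
      obtain U where U: "openin (top_of_set {0..1}) U" "t \<in> U" "\<forall>y\<in>U. \<gamma> y \<in> mball (\<gamma> t) \<epsilon>"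
        using l t eps unfolding continuous_map_to_metric topspace_euclidean_subtopology by blast
      obtain \<delta> where d: "\<delta> > 0" "ball t \<delta> \<inter> {0..1} \<subseteq> U"
        using U(1,2) unfolding openin_contains_ball by blast
      have "dist (\<gamma> t' e) (\<gamma> t e) < \<epsilon>" if "t' \<in> {0..1}" "dist t' t < \<delta>" for t'
      proof -
        have "t' \<in> U" using d(2) that by (auto simp: dist_commute)
        then have "l1_dist E (\<gamma> t) (\<gamma> t') < \<epsilon>" using U(3) by simp
        then show ?thesis using abs_le_l1_dist[OF assms(1) e, of "\<gamma> t" "\<gamma> t'"]
          by (simp add: dist_real_def)
      qed
      then show "\<exists>d>0. \<forall>x'\<in>{0..1}. dist x' t < d \<longrightarrow> dist (\<gamma> x' e) (\<gamma> t e) < \<epsilon>"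
        using d(1) by blast
    qed
    ultimately show ?r by blast
  next
    assume r: ?r
    show ?l
      unfolding continuous_map_to_metric
    proof (intro ballI allI impI)
      fix t \<epsilon> :: real assume "t \<in> topspace (top_of_set {0..1})" and eps: "0 < \<epsilon>"
      then have t: "t \<in> {0..1}" by simp
      have c: "continuous_on {0..1} (\<lambda>u. l1_dist E (\<gamma> t) (\<gamma> u))"
        unfolding l1_dist_def using r by (intro continuous_intros) auto
      let ?U = "{0..1} \<inter> (\<lambda>u. l1_dist E (\<gamma> t) (\<gamma> u)) -` {..<\<epsilon>}"
      have "openin (top_of_set {0..1}) ?U"
        using continuous_openin_preimage_gen[OF c] by simp
      moreover have "t \<in> ?U" using t eps by (simp add: l1_dist_def)
      moreover have "\<forall>u\<in>?U. \<gamma> u \<in> mball (\<gamma> t) \<epsilon>" using r t by auto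
      ultimately show "\<exists>U. openin (top_of_set {0..1}) U \<and> t \<in> U \<and> (\<forall>y\<in>U. \<gamma> y \<in> mball (\<gamma> t) \<epsilon>)"
        by blast
    qed
  qed
qed

text \<open>For \<open>u = 0\<close> this yields that the intrinsic distance dominates the
  l1-distance; for other \<open>u\<close> it bounds the detour through an intermediate point of the
  curve.\<close>

lemma curve_length_ge_via:
  assumes "u \<in> {0..1}"
  shows "ennreal (l1_dist E (\<gamma> 0) (\<gamma> u) + l1_dist E (\<gamma> u) (\<gamma> 1)) \<le> curve_length E \<gamma>"
proof -
  define t :: "nat \<Rightarrow> real" where "t i = (if i = 0 then 0 else if i = 1 then u else 1)" for i
  have "mono_on {..2} t" using assms by (auto simp: t_def monotone_on_def)
  moreover have "t ` {..2} \<subseteq> {0..1}" using assms by (auto simp: t_def)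
  moreover have "(\<Sum>i=1..2. l1_dist E (\<gamma> (t (i - 1))) (\<gamma> (t i))) =
      l1_dist E (\<gamma> 0) (\<gamma> u) + l1_dist E (\<gamma> u) (\<gamma> 1)"
    by (simp add: t_def numeral_2_eq_2)
  ultimately show ?thesis
    unfolding curve_length_def by (intro SUP_upper2[of "(2, t)"]) auto
qed

lemma intrinsic_dist_ge: "ennreal (l1_dist E x y) \<le> intrinsic_dist E L x y"
  unfolding intrinsic_dist_def
proof (rule INF_greatest)
  fix \<gamma> :: "real \<Rightarrow> 'a \<Rightarrow> real" assume "\<gamma> \<in> {\<gamma>. continuous_map (top_of_set {0..1})
      (Metric_space.mtopology (realization E L) (l1_dist E)) \<gamma> \<and> \<gamma> 0 = x \<and> \<gamma> 1 = y}"
  then show "ennreal (l1_dist E x y) \<le> curve_length E \<gamma>"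
    using curve_length_ge_via[of 0 E \<gamma>] by (simp add: l1_dist_def)
qed

text \<open>Every coordinate of a staircase is monotone, so its variation over any partition
  telescopes and is at most \<open>\<bar>x e - y e\<bar>\<close>.\<close>

lemma stair_joined_imp_intrinsic_dist:
  assumes "finite E" "x \<in> extensional E" "y \<in> extensional E" "stair_joined E L x y"
  shows "intrinsic_dist E L x y = ennreal (l1_dist E x y)"
proof (rule antisym[OF _ intrinsic_dist_ge])
  obtain \<tau> where \<tau>: "\<And>t. staircase E x y \<tau> t \<in> realization E L"
    using assms by (auto simp: stair_joined_def)
  \<comment> \<open>At time \<open>a\<close> no coordinate has started to move, at time
    \<open>b\<close> all have arrived; \<open>\<gamma>\<close> rescales this interval to the unit
    interval.\<close>
  define a b where "a = Min (insert 0 (\<tau> ` E))" and "b = Max (insert 0 (\<tau> ` E)) + 1"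
  have a: "a \<le> \<tau> e" if "e \<in> E" for e using assms(1) that by (simp add: a_def)
  have b: "\<tau> e + 1 \<le> b" if "e \<in> E" for e using assms(1) that by (simp add: b_def)
  have "a \<le> 0" "0 \<le> b" using assms(1) by (auto simp: a_def b_def intro: add_nonneg_nonneg)
  then have ab: "a \<le> b" by simp
  define \<gamma> :: "real \<Rightarrow> 'a \<Rightarrow> real" where "\<gamma> u = staircase E x y \<tau> (a + (b - a) * u)" for u
  have "\<gamma> 0 = x"
    using a assms(2) by (intro extensionalityI[of _ E]) (auto simp: \<gamma>_def staircase_def ramp_0)
  moreover have "\<gamma> 1 = y"
    using b assms(3) by (intro extensionalityI[of _ E]) (auto simp: \<gamma>_def staircase_def ramp_1 algebra_simps)
  moreover have "continuous_map (top_of_set {0..1}) (Metric_space.mtopology (realization E L) (l1_dist E)) \<gamma>"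
    unfolding continuous_map_realization_iff[OF assms(1) realization_subset_extensional]
    using \<tau> by (auto simp: \<gamma>_def staircase_def ramp_def intro!: continuous_intros)
  ultimately have "intrinsic_dist E L x y \<le> curve_length E \<gamma>"
    unfolding intrinsic_dist_def by (intro INF_lower) simp
  also have "\<dots> \<le> ennreal (l1_dist E x y)"
    unfolding curve_length_def
  proof (rule SUP_least, clarify)
    fix k and t :: "nat \<Rightarrow> real" assume t: "mono_on {..k} t"
    define s where "s i = a + (b - a) * t i" for i
    have s: "s (i - 1) \<le> s i" if "i \<in> {1..k}" for i
      using that ab by (auto simp: s_def intro!: mult_left_mono monotone_onD[OF t])
    have "(\<Sum>i=1..k. l1_dist E (\<gamma> (t (i - 1))) (\<gamma> (t i))) =
        (\<Sum>e\<in>E. \<Sum>i=1..k. \<bar>\<gamma> (t (i - 1)) e - \<gamma> (t i) e\<bar>)"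
      unfolding l1_dist_def by (rule sum.swap)
    also have "\<dots> \<le> (\<Sum>e\<in>E. \<bar>x e - y e\<bar>)"
    proof (rule sum_mono)
      fix e assume e: "e \<in> E"
      have "\<bar>\<gamma> (t (i - 1)) e - \<gamma> (t i) e\<bar> = (ramp (s i - \<tau> e) - ramp (s (i - 1) - \<tau> e)) * \<bar>x e - y e\<bar>"
        if "i \<in> {1..k}" for i
      proof -
        have "ramp (s (i - 1) - \<tau> e) \<le> ramp (s i - \<tau> e)"
          using s[OF that] by (intro ramp_mono) simp
        moreover have "\<gamma> (t (i - 1)) e - \<gamma> (t i) e = (ramp (s i - \<tau> e) - ramp (s (i - 1) - \<tau> e)) * (x e - y e)"
          using e by (simp add: \<gamma>_def staircase_def s_def algebra_simps)
        ultimately show ?thesis by (simp add: abs_mult)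
      qed
      then have "(\<Sum>i=1..k. \<bar>\<gamma> (t (i - 1)) e - \<gamma> (t i) e\<bar>) =
          (\<Sum>i=Suc 0..k. ramp (s i - \<tau> e) - ramp (s (i - 1) - \<tau> e)) * \<bar>x e - y e\<bar>"
        by (simp add: sum_distrib_right)
      also have "\<dots> = (ramp (s k - \<tau> e) - ramp (s 0 - \<tau> e)) * \<bar>x e - y e\<bar>"
        by (subst sum_telescope''[of 0 k]) auto
      also have "\<dots> \<le> 1 * \<bar>x e - y e\<bar>"
        using ramp_bounds(1)[of "s 0 - \<tau> e"] ramp_bounds(2)[of "s k - \<tau> e"]
        by (intro mult_right_mono) auto
      finally show "(\<Sum>i=1..k. \<bar>\<gamma> (t (i - 1)) e - \<gamma> (t i) e\<bar>) \<le> \<bar>x e - y e\<bar>" by simp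
    qed
    finally show "ennreal (\<Sum>i=1..k. l1_dist E (\<gamma> (t (i - 1))) (\<gamma> (t i))) \<le> ennreal (l1_dist E x y)"
      unfolding l1_dist_def by (rule ennreal_leI)
  qed
  finally show "intrinsic_dist E L x y \<le> ennreal (l1_dist E x y)" .
qed

subsection \<open>Weak convexity and sign-convexity\<close>

text \<open>Far out in the sequence, the sign coordinates of \<open>\<sigma> n\<close> are among
  those of the limit and have the same values. A sign map that matches the limit thus matches
  \<open>\<sigma> n\<close>, which lies in |L|.\<close>

lemma mcomplete_realization:
  assumes "finite E"
  shows "Metric_space.mcomplete (realization E L) (l1_dist E)"
proof -
  interpret Metric_space "realization E L" "l1_dist E"
    by (rule Metric_space_l1_dist[OF assms realization_subset_extensional])
  show ?thesis
    unfolding mcomplete_def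
  proof (intro allI impI)
    fix \<sigma> assume \<sigma>: "MCauchy \<sigma>"
    then have \<sigma>K: "\<sigma> n \<in> realization E L" for n by (auto simp: MCauchy_def)
    have conv: "convergent (\<lambda>n. \<sigma> n e)" if e: "e \<in> E" for e
    proof (rule real_Cauchy_convergent, rule metric_CauchyI)
      fix \<epsilon> :: real assume "0 < \<epsilon>"
      then obtain N where N: "\<And>m n. N \<le> m \<Longrightarrow> N \<le> n \<Longrightarrow> l1_dist E (\<sigma> m) (\<sigma> n) < \<epsilon>"
        using \<sigma> unfolding MCauchy_def by meson
      have "dist (\<sigma> m e) (\<sigma> n e) < \<epsilon>" if "N \<le> m" "N \<le> n" for m n
        using N[OF that] abs_le_l1_dist[OF assms e, of "\<sigma> m" "\<sigma> n"] by (simp add: dist_real_def)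
      then show "\<exists>M. \<forall>m\<ge>M. \<forall>n\<ge>M. dist (\<sigma> m e) (\<sigma> n e) < \<epsilon>" by blast
    qed
    define l where "l = (\<lambda>e\<in>E. lim (\<lambda>n. \<sigma> n e))"
    have l: "(\<lambda>n. \<sigma> n e) \<longlonglongrightarrow> l e" if "e \<in> E" for e
      using conv[OF that] that by (simp add: l_def convergent_LIMSEQ_iff)
    have lle: "\<bar>l e\<bar> \<le> 1" if e: "e \<in> E" for e
      by (rule LIMSEQ_le_const2[OF tendsto_rabs[OF l[OF e]]])
        (use realization_abs_le[OF \<sigma>K e] in blast)
    have lK: "l \<in> realization E L"
      unfolding realization_iff
    proof (intro conjI ballI impI)
      show "l \<in> cube E" using lle by (simp add: cube_iff l_def)
      fix r assume r: "r \<in> sign_maps E" "\<forall>e\<in>E. \<bar>l e\<bar> = 1 \<longrightarrow> r e = l e"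
      have "\<forall>\<^sub>F n in sequentially. \<forall>e\<in>E. \<bar>\<sigma> n e\<bar> = 1 \<longrightarrow> \<sigma> n e = r e"
      proof (intro eventually_ball_finite assms ballI)
        fix e assume e: "e \<in> E"
        show "\<forall>\<^sub>F n in sequentially. \<bar>\<sigma> n e\<bar> = 1 \<longrightarrow> \<sigma> n e = r e"
        proof (cases "\<bar>l e\<bar> = 1")
          case True
          \<comment> \<open>Distance below 1 rules out the opposite sign:
            \<open>\<sigma> n e\<close> is then interior or equal to \<open>l e\<close>.\<close>
          have "\<forall>\<^sub>F n in sequentially. dist (\<sigma> n e) (l e) < 1"
            using tendstoD[OF l[OF e]] by simp
          then show ?thesis
          proof eventually_elim
            case (elim n)
            then show ?case using True r(2) e by (auto simp: dist_real_def abs_if split: if_splits)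
          qed
        next
          case False
          then have "\<bar>l e\<bar> < 1" using lle[OF e] by simp
          then have "\<forall>\<^sub>F n in sequentially. \<bar>\<sigma> n e\<bar> < 1"
            by (rule order_tendstoD(2)[OF tendsto_rabs[OF l[OF e]]])
          then show ?thesis by eventually_elim auto
        qed
      qed
      then obtain n where "\<forall>e\<in>E. \<bar>\<sigma> n e\<bar> = 1 \<longrightarrow> \<sigma> n e = r e"
        by (auto simp: eventually_sequentially)
      then show "r \<in> L" by (intro realizationD[OF \<sigma>K r(1)]) auto
    qed
    have "(\<lambda>n. l1_dist E (\<sigma> n) l) \<longlonglongrightarrow> (\<Sum>e\<in>E. \<bar>l e - l e\<bar>)"
      unfolding l1_dist_def by (intro tendsto_intros l)
    then have lim0: "(\<lambda>n. l1_dist E (\<sigma> n) l) \<longlonglongrightarrow> 0" by simp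
    have "limitin mtopology \<sigma> l sequentially"
      unfolding limit_metric_sequentially
    proof (intro conjI allI impI lK)
      fix \<epsilon> :: real assume "0 < \<epsilon>"
      from order_tendstoD(2)[OF lim0 this]
      show "\<exists>N. \<forall>n\<ge>N. \<sigma> n \<in> realization E L \<and> l1_dist E (\<sigma> n) l < \<epsilon>"
        using \<sigma>K by (auto simp: eventually_sequentially)
    qed
    then show "\<exists>x. limitin mtopology \<sigma> x sequentially" by blast
  qed
qed

lemma midface_property_imp_weakly_convex:
  assumes "finite E" "midface_property E L"
  shows "weakly_convex E (realization E L)"
  unfolding weakly_convex_def
proof (intro conjI ballI impI mcomplete_realization assms)
  fix x y assume xy: "x \<in> realization E L" "y \<in> realization E L" "x \<noteq> y"
  obtain e where e: "e \<in> E" "x e \<noteq> y e" and alt: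
    "(\<forall>c. \<bar>c\<bar> \<le> 1 \<longrightarrow> x(e := c) \<in> realization E L) \<or> (\<forall>c. \<bar>c\<bar> \<le> 1 \<longrightarrow> y(e := c) \<in> realization E L)"
    using midface_property_imp_axis_step[OF assms xy] by blast
  define c where "c = (x e + y e) / 2"
  have "\<bar>x e\<bar> \<le> 1" "\<bar>y e\<bar> \<le> 1" using realization_abs_le[of _ E L e] xy e(1) by auto
  then have c: "\<bar>c\<bar> \<le> 1" by (simp add: c_def abs_le_iff)
  have ce: "c \<noteq> x e" "c \<noteq> y e" using e(2) by (auto simp: c_def field_simps)
  have mid: "\<bar>x e - y e\<bar> = \<bar>x e - c\<bar> + \<bar>c - y e\<bar>" by (simp add: c_def abs_if field_simps)
  have x: "x(e := c) \<noteq> x \<and> x(e := c) \<noteq> y \<and>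
      l1_dist E x y = l1_dist E x (x(e := c)) + l1_dist E (x(e := c)) y"
    unfolding l1_dist_between_iff[OF assms(1)] using ce mid by (auto dest: fun_cong[of _ _ e])
  have y: "y(e := c) \<noteq> x \<and> y(e := c) \<noteq> y \<and>
      l1_dist E x y = l1_dist E x (y(e := c)) + l1_dist E (y(e := c)) y"
    unfolding l1_dist_between_iff[OF assms(1)] using ce mid by (auto dest: fun_cong[of _ _ e])
  show "\<exists>r\<in>realization E L. r \<noteq> x \<and> r \<noteq> y \<and> l1_dist E x y = l1_dist E x r + l1_dist E r y"
    using alt c x y by blast
qed

text \<open>A point \<open>z\<close> between \<open>x\<close> and \<open>y\<close> agrees with them
  on their common coordinates. If it is a sign at every other coordinate, then
  \<open>z \<noteq> x\<close> and \<open>z \<noteq> y\<close> are witnessed by sign coordinates,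
  which is the second alternative.\<close>

lemma weakly_convex_imp_midface_property:
  assumes "finite E" "weakly_convex E (realization E L)"
  shows "midface_property E L"
  unfolding midface_property_def
proof (intro ballI impI)
  fix x y assume "x \<in> Baryc E L" "y \<in> Baryc E L" "x \<noteq> y"
  then have xy: "x \<in> realization E L" "y \<in> realization E L" by (auto simp: Baryc_iff)
  then obtain z where z: "z \<in> realization E L" "z \<noteq> x" "z \<noteq> y"
    "l1_dist E x y = l1_dist E x z + l1_dist E z y"
    using assms(2) \<open>x \<noteq> y\<close> unfolding weakly_convex_def by blast
  have btw: "\<bar>x e - y e\<bar> = \<bar>x e - z e\<bar> + \<bar>z e - y e\<bar>" if "e \<in> E" for e
    using z(4) that unfolding l1_dist_between_iff[OF assms(1)] by blast
  have eq: "z e = x e" if "e \<in> E" "x e = y e" for e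
    using btw[OF that(1)] that(2) by simp
  have ext: "x \<in> extensional E" "y \<in> extensional E" "z \<in> extensional E"
    using xy z(1) realization_subset_extensional by auto
  have alt: "(\<exists>e\<in>E. x e \<noteq> y e \<and> \<bar>z e\<bar> < 1) \<or>
         (\<exists>e\<in>E. \<bar>z e\<bar> = 1 \<and> z e \<noteq> x e) \<and> (\<exists>e\<in>E. \<bar>z e\<bar> = 1 \<and> z e \<noteq> y e)"
  proof (cases "\<exists>e\<in>E. x e \<noteq> y e \<and> \<bar>z e\<bar> < 1")
    case False
    then have one: "\<bar>z e\<bar> = 1" if "e \<in> E" "x e \<noteq> y e" for e
      using realization_abs_le[OF z(1) that(1)] that by force
    obtain e where e: "e \<in> E" "z e \<noteq> x e" using z(2) extensionalityI[OF ext(3,1)] by blast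
    obtain f where f: "f \<in> E" "z f \<noteq> y f" using z(3) extensionalityI[OF ext(3,2)] by blast
    have "\<bar>z e\<bar> = 1" "\<bar>z f\<bar> = 1" using one eq e f by metis+
    then show ?thesis using e f by blast
  qed blast
  show "\<exists>z\<in>realization E L. (\<forall>e\<in>E. x e = y e \<longrightarrow> z e = x e \<or> \<bar>z e\<bar> < 1) \<and>
        ((\<exists>e\<in>E. x e \<noteq> y e \<and> \<bar>z e\<bar> < 1) \<or>
         (\<exists>e\<in>E. \<bar>z e\<bar> = 1 \<and> z e \<noteq> x e) \<and> (\<exists>e\<in>E. \<bar>z e\<bar> = 1 \<and> z e \<noteq> y e))"
    using z(1) eq alt by blast
qed

text \<open>The staircase from \<open>x\<close> to \<open>y\<close> is stopped when coordinate
  \<open>e\<close> vanishes. Every other coordinate is then a convex combination of its end values,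
  so without a strict sign change its sign is one of theirs.\<close>

lemma midface_property_imp_sign_convex_realization:
  assumes "finite E" "midface_property E L"
  shows "sign_convex E (realization E L)"
  unfolding sign_convex_def
proof (intro ballI impI)
  fix x y e assume xy: "x \<in> realization E L" "y \<in> realization E L" and e: "e \<in> E" "x e * y e < 0"
  obtain \<tau> where \<tau>: "\<And>t. staircase E x y \<tau> t \<in> realization E L"
    using midface_property_imp_stair_joined[OF assms xy] by (auto simp: stair_joined_def)
  \<comment> \<open>The zero of the linear motion from \<open>x e\<close> to \<open>y e\<close>;
    \<open>e\<close> moves from time \<open>\<tau> e\<close> on, so it vanishes at
    \<open>\<tau> e + c\<close>.\<close>
  define c where "c = x e / (x e - y e)"
  have ne: "x e - y e \<noteq> 0" using e(2) by (auto simp: mult_less_0_iff)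
  have c: "0 \<le> c" "c \<le> 1"
    using e(2) ne by (auto simp: c_def divide_simps mult_less_0_iff)
  define z where "z = staircase E x y \<tau> (\<tau> e + c)"
  have "ramp c = c" using c by (simp add: ramp_def)
  then have "z e = x e + c * (y e - x e)" using e(1) by (simp add: z_def staircase_def)
  also have "\<dots> = 0" using ne by (simp add: c_def field_simps)
  finally have ze: "z e = 0" .
  have "sgn (z f) \<in> {sgn (x f), sgn (y f)}" if f: "f \<in> E" "x f * y f \<ge> 0" for f
  proof -
    define d where "d = ramp (\<tau> e + c - \<tau> f)"
    have d: "0 \<le> d" "d \<le> 1" using ramp_bounds by (auto simp: d_def)
    have zf: "z f = (1 - d) * x f + d * y f"
      using f(1) by (simp add: z_def staircase_def d_def algebra_simps)
    consider "d = 0" | "d = 1" | "0 < d" "d < 1" using d by fastforce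
    then show ?thesis
    proof cases
      case 3
      have p: "sgn ((1 - d) * x f) = sgn (x f)" "sgn (d * y f) = sgn (y f)"
        using 3 by (simp_all add: sgn_mult)
      have "sgn (u + v) \<in> {sgn u, sgn v}" if "sgn u * sgn v \<ge> 0" for u v :: real
        using that by (auto simp: sgn_if split: if_splits)
      from this[of "(1 - d) * x f" "d * y f"] show ?thesis
        using f(2) unfolding zf p by (simp add: sgn_mult[symmetric])
    qed (simp_all add: zf)
  qed
  then show "\<exists>r\<in>realization E L. r e = 0 \<and>
      (\<forall>f\<in>E. 0 \<le> x f * y f \<longrightarrow> sgn (r f) \<in> {sgn (x f), sgn (y f)})"
    using \<tau> ze unfolding z_def by blast
qed

text \<open>Taking signs fixes further coordinates at 1 or -1 and keeps those already fixed. It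
  turns a sign-convexity witness in |L| into one among the barycenters.\<close>

lemma sgn_mem_Baryc:
  assumes "z \<in> realization E L"
  shows "(\<lambda>e\<in>E. sgn (z e)) \<in> Baryc E L"
  unfolding Baryc_iff realization_iff
proof (intro conjI ballI impI)
  show "(\<lambda>e\<in>E. sgn (z e)) \<in> cube E" by (auto simp: cube_iff sgn_if)
  show "(\<lambda>e\<in>E. sgn (z e)) e \<in> {-1, 0, 1}" if "e \<in> E" for e using that by (auto simp: sgn_if)
  fix r assume r: "r \<in> sign_maps E"
    "\<forall>e\<in>E. \<bar>(\<lambda>e\<in>E. sgn (z e)) e\<bar> = 1 \<longrightarrow> r e = (\<lambda>e\<in>E. sgn (z e)) e"
  show "r \<in> L"
    by (rule realizationD[OF assms r(1)])
      (use r(2) in \<open>auto simp: sgn_if abs_if split: if_splits\<close>)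
qed

lemma sign_convex_realization_imp_Baryc:
  assumes "sign_convex E (realization E L)"
  shows "sign_convex E (Baryc E L)"
  unfolding sign_convex_def
proof (intro ballI impI)
  fix x y e assume xy: "x \<in> Baryc E L" "y \<in> Baryc E L" "x \<noteq> y" and e: "e \<in> E" "x e * y e < 0"
  then have "x \<in> realization E L" "y \<in> realization E L" by (auto simp: Baryc_iff)
  then obtain z where z: "z \<in> realization E L" "z e = 0"
    "\<forall>f\<in>E. 0 \<le> x f * y f \<longrightarrow> sgn (z f) \<in> {sgn (x f), sgn (y f)}"
    using assms xy(3) e unfolding sign_convex_def by blast
  show "\<exists>r\<in>Baryc E L. r e = 0 \<and>
      (\<forall>f\<in>E. 0 \<le> x f * y f \<longrightarrow> sgn (r f) \<in> {sgn (x f), sgn (y f)})"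
    using sgn_mem_Baryc[OF z(1)] z(2,3) e(1)
    by (intro bexI[of _ "\<lambda>e\<in>E. sgn (z e)"]) auto
qed

text \<open>These are the directions of the faces of |L|: a point vanishing on \<open>A\<close> lies
  in a face whose direction contains \<open>A\<close>, and that face has subfaces of direction
  \<open>A\<close>. A condition on points passes to fibers by restriction.\<close>

definition strongly_shattered_sets :: "'a set \<Rightarrow> ('a \<Rightarrow> real) set \<Rightarrow> 'a set set" where
  "strongly_shattered_sets E L = {A. A \<subseteq> E \<and> (\<exists>x\<in>realization E L. \<forall>e\<in>A. x e = 0)}"

lemma finite_strongly_shattered_sets: "finite E \<Longrightarrow> finite (strongly_shattered_sets E L)"
  by (auto simp: strongly_shattered_sets_def)

text \<open>The other half of the sandwich theorem. Sets without \<open>e\<close> remain strongly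
  shattered by the union of the fibers; for sets containing \<open>e\<close>, the rest is strongly
  shattered by the intersection.\<close>

lemma card_strongly_shattered_sets_le:
  assumes "finite E" "L \<subseteq> sign_maps E"
  shows "card (strongly_shattered_sets E L) \<le> card L"
  using assms
proof (induction E arbitrary: L rule: finite_induct)
  case empty
  have fin: "finite L" by (rule finite_subset[OF empty finite_sign_maps[OF finite.emptyI]])
  show ?case
  proof (cases "L = {}")
    case True
    then have "strongly_shattered_sets {} L = {}"
      by (auto simp: strongly_shattered_sets_def realization_iff sign_maps_def)
    then show ?thesis by simp
  next
    case False
    have "card (strongly_shattered_sets {} L) \<le> card {{} :: 'a set}"
      by (rule card_mono) (auto simp: strongly_shattered_sets_def)
    also have "\<dots> \<le> card L" using False fin by (simp add: Suc_le_eq card_gt_0_iff)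
    finally show ?thesis .
  qed
next
  case (insert e E)
  let ?P = "fiber E e 1 L" and ?N = "fiber E e (-1) L"
  let ?S = "strongly_shattered_sets (insert e E) L"
  have fin: "finite ?P" "finite ?N"
    by (rule finite_subset[OF fiber_subset finite_sign_maps[OF insert.hyps(1)]])+
  have PN: "?P \<union> ?N \<subseteq> sign_maps E" "?P \<inter> ?N \<subseteq> sign_maps E" by (auto simp: fiber_def)
  have "A \<in> strongly_shattered_sets E (?P \<union> ?N)" if A: "A \<subseteq> E" "A \<in> ?S" for A
  proof -
    obtain x where x: "x \<in> realization (insert e E) L" "\<forall>f\<in>A. x f = 0"
      using A by (auto simp: strongly_shattered_sets_def)
    \<comment> \<open>The fiber is prescribed if \<open>x e\<close> is 1 or -1; at interior values 1
      is an arbitrary choice.\<close>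
    define c where "c = (if x e = -1 then -1 else 1 :: real)"
    have "restrict x E \<in> realization E (fiber E e c L)"
      by (rule realization_restrict[OF insert.hyps(2) x(1)]) (auto simp: c_def)
    moreover have "fiber E e c L \<subseteq> ?P \<union> ?N" by (auto simp: c_def)
    ultimately have "restrict x E \<in> realization E (?P \<union> ?N)" using realization_mono by blast
    moreover have "\<forall>f\<in>A. restrict x E f = 0" using x(2) A by auto
    ultimately show ?thesis using A(1) unfolding strongly_shattered_sets_def by blast
  qed
  then have 1: "card {A. A \<subseteq> E \<and> A \<in> ?S} \<le> card (strongly_shattered_sets E (?P \<union> ?N))"
    by (intro card_mono finite_strongly_shattered_sets insert.hyps) auto
  have "A \<in> strongly_shattered_sets E (?P \<inter> ?N)" if A: "A \<subseteq> E" "insert e A \<in> ?S" for A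
  proof -
    obtain x where x: "x \<in> realization (insert e E) L" "\<forall>f\<in>insert e A. x f = 0"
      using A by (auto simp: strongly_shattered_sets_def)
    have "restrict x E \<in> realization E (fiber E e c L)" if "c = -1 \<or> c = 1" for c
      by (rule realization_restrict[OF insert.hyps(2) x(1) that]) (use x(2) in auto)
    then have "restrict x E \<in> realization E (?P \<inter> ?N)" by (simp add: realization_Int)
    moreover have "\<forall>f\<in>A. restrict x E f = 0" using x(2) A by auto
    ultimately show ?thesis using A(1) unfolding strongly_shattered_sets_def by blast
  qed
  then have 2: "card {A. A \<subseteq> E \<and> insert e A \<in> ?S} \<le> card (strongly_shattered_sets E (?P \<inter> ?N))"
    by (intro card_mono finite_strongly_shattered_sets insert.hyps) auto
  have "?S \<subseteq> Pow (insert e E)" by (auto simp: strongly_shattered_sets_def)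
  from card_Pow_insert_decomp[OF insert.hyps this]
  have "card ?S \<le> card (strongly_shattered_sets E (?P \<union> ?N)) + card (strongly_shattered_sets E (?P \<inter> ?N))"
    using 1 2 by simp
  also have "\<dots> \<le> card (?P \<union> ?N) + card (?P \<inter> ?N)"
    by (intro add_mono insert.IH PN)
  also have "\<dots> = card L"
    by (simp add: card_fibers[OF insert.hyps insert.prems] card_Un_Int[OF fin])
  finally show ?case .
qed

text \<open>Every shattered set is shown to be strongly shattered, so the two outer numbers of the
  sandwich theorem coincide.\<close>

lemma sign_convex_Baryc_imp_ample:
  assumes "finite E" "L \<subseteq> sign_maps E" "sign_convex E (Baryc E L)"
  shows "ample E L"
proof -
  have "A \<in> strongly_shattered_sets E L" if A: "A \<in> shattered_sets E L" for A
  proof -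
    have AE: "A \<subseteq> E" and sh: "\<forall>a\<in>sign_maps A. \<exists>s\<in>L. \<forall>e\<in>A. s e = a e"
      using A shattered_iff[OF assms(2)] by (auto simp: shattered_sets_def)
    have "finite A" using AE assms(1) finite_subset by blast
    \<comment> \<open>Zeros are created on \<open>A\<close> one coordinate at a time. Extra zeros in
      \<open>A\<close> outside \<open>B\<close> must be allowed, since sign-convexity may create
      them.\<close>
    have claim: "\<forall>a\<in>sign_maps A. \<exists>x\<in>Baryc E L. (\<forall>f\<in>B. x f = 0) \<and> (\<forall>f\<in>A. x f = a f \<or> x f = 0)"
      if "B \<subseteq> A" for B
      using finite_subset[OF that \<open>finite A\<close>] that
    proof (induction B rule: finite_induct)
      case empty
      show ?case
      proof
        fix a assume "a \<in> sign_maps A"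
        then obtain s where s: "s \<in> L" "\<forall>e\<in>A. s e = a e" using sh by blast
        have "s \<in> sign_maps E" using s assms(2) by blast
        then have "s \<in> Baryc E L"
          using sign_maps_Int_realization[of E L] s(1) by (auto simp: Baryc_iff sign_maps_iff)
        then show "\<exists>x\<in>Baryc E L. (\<forall>f\<in>{}. x f = 0) \<and> (\<forall>f\<in>A. x f = a f \<or> x f = 0)"
          using s(2) by blast
      qed
    next
      case (insert e B)
      show ?case
      proof
        fix a assume a: "a \<in> sign_maps A"
        have e: "e \<in> A" "e \<in> E" using insert.prems AE by auto
        have IH: "\<forall>a\<in>sign_maps A. \<exists>x\<in>Baryc E L. (\<forall>f\<in>B. x f = 0) \<and> (\<forall>f\<in>A. x f = a f \<or> x f = 0)"
          using insert by simp
        have a': "a(e := - a e) \<in> sign_maps A"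
          using a e(1) by (auto simp: sign_maps_iff extensional_def)
        obtain x where x: "x \<in> Baryc E L" "\<forall>f\<in>B. x f = 0" "\<forall>f\<in>A. x f = a f \<or> x f = 0"
          using IH a by blast
        obtain y where y: "y \<in> Baryc E L" "\<forall>f\<in>B. y f = 0" "\<forall>f\<in>A. y f = (a(e := - a e)) f \<or> y f = 0"
          using IH a' by blast
        show "\<exists>x\<in>Baryc E L. (\<forall>f\<in>insert e B. x f = 0) \<and> (\<forall>f\<in>A. x f = a f \<or> x f = 0)"
        proof (cases "x e = 0 \<or> y e = 0")
          case True
          then show ?thesis
          proof
            assume "x e = 0"
            then show ?thesis using x by (intro bexI[of _ x]) auto
          next
            assume "y e = 0"
            moreover from this have "\<forall>f\<in>A. y f = a f \<or> y f = 0" using y(3) by (metis fun_upd_apply)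
            ultimately show ?thesis using y by (intro bexI[of _ y]) auto
          qed
        next
          case False
          then have xe: "x e = a e" "y e = - a e" using x(3) y(3) e(1) by (metis fun_upd_same)+
          then have "x e * y e < 0" "x \<noteq> y" using False by (auto simp: mult_less_0_iff zero_less_mult_iff)
          \<comment> \<open>The patterns behind \<open>x\<close> and \<open>y\<close> differ only at
            \<open>e\<close>. At all other coordinates of \<open>A\<close> the product is
            nonnegative, so \<open>z\<close> keeps the zeros on \<open>B\<close> and takes no sign
            other than that of \<open>a\<close>.\<close>
          then obtain z where z: "z \<in> Baryc E L" "z e = 0"
            "\<forall>f\<in>E. 0 \<le> x f * y f \<longrightarrow> sgn (z f) \<in> {sgn (x f), sgn (y f)}"
            using assms(3) x(1) y(1) e(2) unfolding sign_convex_def by blast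
          have "z f = 0" if "f \<in> B" for f
          proof -
            have "f \<in> E" using that insert.prems AE by auto
            then have "sgn (z f) = 0" using z(3) x(2) y(2) that by force
            then show ?thesis by (simp add: sgn_zero_iff)
          qed
          moreover have "z f = a f \<or> z f = 0" if f: "f \<in> A" for f
          proof (cases "f = e")
            case False
            have fE: "f \<in> E" using f AE by auto
            have xf: "x f = a f \<or> x f = 0" and yf: "y f = a f \<or> y f = 0"
              using x(3) y(3) f False by auto
            then have "0 \<le> x f * y f" by auto
            then have "sgn (z f) = sgn (x f) \<or> sgn (z f) = sgn (y f)" using z(3) fE by blast
            then have "sgn (z f) = sgn (a f) \<or> sgn (z f) = sgn 0" using xf yf by auto
            moreover have "sgn (z f) = z f" using Baryc_cases[OF z(1) fE] by (metis sgn_0 sgn_1 sgn_minus)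
            moreover have "sgn (a f) = a f" using a f unfolding sign_maps_iff by (metis sgn_1 sgn_minus)
            ultimately show ?thesis by simp
          qed (simp add: z(2))
          ultimately show ?thesis using z(1,2) by (intro bexI[of _ z]) auto
        qed
      qed
    qed
    have "(\<lambda>e\<in>A. 1) \<in> sign_maps A" by (auto simp: sign_maps_iff)
    with claim[of A] obtain x where "x \<in> Baryc E L" "\<forall>f\<in>A. x f = 0" by blast
    then show ?thesis using AE by (auto simp: strongly_shattered_sets_def Baryc_iff)
  qed
  then have "card (shattered_sets E L) \<le> card (strongly_shattered_sets E L)"
    by (intro card_mono finite_strongly_shattered_sets assms) auto
  then show ?thesis
    using card_strongly_shattered_sets_le[OF assms(1,2)] card_le_card_shattered_sets[OF assms(1,2)]
    by (simp add: ample_iff)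
qed

subsection \<open>Isometry, gates and the intrinsic metric\<close>

lemma sign_maps_mem_Baryc_iff: "s \<in> sign_maps E \<Longrightarrow> s \<in> Baryc E L \<longleftrightarrow> s \<in> L"
  using sign_maps_Int_realization[of E L] by (auto simp: Baryc_iff sign_maps_iff)

lemma card_diff_le_path_length:
  assumes "finite E" "p \<noteq> []" "successively (adjacent E) p"
  shows "card {e\<in>E. hd p e \<noteq> last p e} \<le> length p - 1"
  using assms(2,3)
proof (induction p)
  case (Cons s q)
  show ?case
  proof (cases "q = []")
    case False
    then have q: "adjacent E s (hd q)" "successively (adjacent E) q"
      using Cons.prems by (auto simp: successively_Cons)
    have "card {e\<in>E. s e \<noteq> last q e} \<le> card ({e\<in>E. s e \<noteq> hd q e} \<union> {e\<in>E. hd q e \<noteq> last q e})"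
      using assms(1) by (intro card_mono) auto
    also have "\<dots> \<le> 1 + card {e\<in>E. hd q e \<noteq> last q e}"
      using card_Un_le[of "{e\<in>E. s e \<noteq> hd q e}" "{e\<in>E. hd q e \<noteq> last q e}"] q(1)
      by (simp add: adjacent_def)
    also have "\<dots> \<le> 1 + (length q - 1)"
      using Cons.IH[OF False q(2)] by simp
    finally show ?thesis using False by (cases q) auto
  qed simp
qed simp

text \<open>The second vertex \<open>u\<close> of a shortest path must be closer to
  \<open>t\<close>, because the rest of the path is one edge shorter; hence the first edge flips a
  coordinate at which \<open>s\<close> and \<open>t\<close> differ.\<close>

lemma isometric_flip:
  assumes "finite E" "L \<subseteq> sign_maps E" "isometric E L" "s \<in> L" "t \<in> L" "s \<noteq> t"
  shows "\<exists>e\<in>E. s e \<noteq> t e \<and> s(e := t e) \<in> L"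
proof -
  obtain p where p: "p \<noteq> []" "set p \<subseteq> L" "successively (adjacent E) p" "hd p = s" "last p = t"
    "2 * real (length p - 1) = l1_dist E s t"
    using assms(3-5) unfolding isometric_def by blast
  have st: "s \<in> sign_maps E" "t \<in> sign_maps E" using assms by auto
  have len: "length p - 1 = card {e\<in>E. s e \<noteq> t e}"
    using p(6) l1_dist_sign_maps[OF assms(1) st] by simp
  obtain q where q: "p = s # q" "q \<noteq> []"
    using p(1,4,5) assms(6) by (cases p) (auto split: if_splits)
  define u where "u = hd q"
  have u: "u \<in> L" using p(2) q by (auto simp: u_def)
  then have us: "u \<in> sign_maps E" using assms(2) by auto
  have "adjacent E s u" and sq: "successively (adjacent E) q"
    using p(3) q by (auto simp: successively_Cons u_def)
  then obtain e where e: "{f\<in>E. s f \<noteq> u f} = {e}" by (auto simp: adjacent_def card_1_singleton_iff)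
  then have eE: "e \<in> E" and "s e \<noteq> u e" by auto
  have same: "s f = u f" if "f \<in> E" "f \<noteq> e" for f using e that by blast
  have "card {f\<in>E. u f \<noteq> t f} \<le> length q - 1"
    using card_diff_le_path_length[OF assms(1) q(2) sq] p(5) q by (simp add: u_def)
  also have "\<dots> < card {f\<in>E. s f \<noteq> t f}"
    using len q by (cases q) auto
  finally have less: "card {f\<in>E. u f \<noteq> t f} < card {f\<in>E. s f \<noteq> t f}" .
  have ne: "s e \<noteq> t e"
  proof
    assume "s e = t e"
    then have "{f\<in>E. s f \<noteq> t f} \<subseteq> {f\<in>E. u f \<noteq> t f}"
      using same by (metis (mono_tags, lifting) Collect_mono)
    then have "card {f\<in>E. s f \<noteq> t f} \<le> card {f\<in>E. u f \<noteq> t f}"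
      using assms(1) by (intro card_mono) auto
    with less show False by simp
  qed
  have "u e = t e"
    using ne \<open>s e \<noteq> u e\<close> st us eE unfolding sign_maps_iff by metis
  then have "u = s(e := t e)"
    using same st us eE by (intro extensionalityI[of _ E]) (auto simp: sign_maps_iff extensional_def)
  then show ?thesis using u ne eE by auto
qed

lemma isometric_if_flip:
  assumes "finite E" "L \<subseteq> sign_maps E"
    and flip: "\<And>s t. s \<in> L \<Longrightarrow> t \<in> L \<Longrightarrow> s \<noteq> t \<Longrightarrow> \<exists>e\<in>E. s e \<noteq> t e \<and> s(e := t e) \<in> L"
  shows "isometric E L"
proof -
  \<comment> \<open>The last clause gives distinctness: after the flip at \<open>e\<close> no vertex
    of the path differs from \<open>t\<close> at \<open>e\<close>, whereas \<open>s\<close>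
    does.\<close>
  have "\<exists>p. p \<noteq> [] \<and> distinct p \<and> set p \<subseteq> L \<and> successively (adjacent E) p \<and>
      hd p = s \<and> last p = t \<and> length p - 1 = card {e\<in>E. s e \<noteq> t e} \<and>
      (\<forall>u\<in>set p. {e\<in>E. u e \<noteq> t e} \<subseteq> {e\<in>E. s e \<noteq> t e})"
    if "s \<in> L" "t \<in> L" for s t
    using that
  proof (induction "card {e\<in>E. s e \<noteq> t e}" arbitrary: s rule: less_induct)
    case less
    show ?case
    proof (cases "s = t")
      case True
      then show ?thesis using less.prems by (intro exI[of _ "[s]"]) auto
    next
      case False
      then obtain e where e: "e \<in> E" "s e \<noteq> t e" "s(e := t e) \<in> L"
        using flip less.prems by blast
      have D: "{f\<in>E. s f \<noteq> t f} = insert e {f\<in>E. (s(e := t e)) f \<noteq> t f}" using e by auto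
      have card: "card {f\<in>E. s f \<noteq> t f} = Suc (card {f\<in>E. (s(e := t e)) f \<noteq> t f})"
        unfolding D using assms(1) by (subst card_insert_disjoint) auto
      obtain p where p: "p \<noteq> []" "distinct p" "set p \<subseteq> L" "successively (adjacent E) p"
        "hd p = s(e := t e)" "last p = t" "length p - 1 = card {f\<in>E. (s(e := t e)) f \<noteq> t f}"
        "\<forall>u\<in>set p. {f\<in>E. u f \<noteq> t f} \<subseteq> {f\<in>E. (s(e := t e)) f \<noteq> t f}"
        using less.hyps[OF _ e(3) less.prems(2)] card by auto
      have "s \<notin> set p"
      proof
        assume "s \<in> set p"
        then have "{f\<in>E. s f \<noteq> t f} \<subseteq> {f\<in>E. (s(e := t e)) f \<noteq> t f}" using p(8) by blast
        then have "e \<in> {f\<in>E. (s(e := t e)) f \<noteq> t f}" using e by blast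
        then show False by simp
      qed
      moreover have "adjacent E s (hd p)"
      proof -
        have "{f\<in>E. s f \<noteq> (s(e := t e)) f} = {e}" using e by auto
        then show ?thesis by (simp only: p(5) adjacent_def, simp)
      qed
      moreover have "\<forall>u\<in>set p. {f\<in>E. u f \<noteq> t f} \<subseteq> {f\<in>E. s f \<noteq> t f}"
        using p(8) D by blast
      moreover have "length (s # p) - 1 = card {f\<in>E. s f \<noteq> t f}"
        using card p(1,7) by (cases p) auto
      ultimately show ?thesis
        using p less.prems by (intro exI[of _ "s # p"]) (auto simp: successively_Cons)
    qed
  qed
  moreover have "l1_dist E s t = 2 * real (card {e\<in>E. s e \<noteq> t e})" if "s \<in> L" "t \<in> L" for s t
    using l1_dist_sign_maps[OF assms(1)] assms(2) that by blast
  ultimately show ?thesis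
    unfolding isometric_def by (intro ballI) (metis (no_types, lifting))
qed

lemma midface_property_imp_isometric:
  assumes "finite E" "L \<subseteq> sign_maps E" "midface_property E L"
  shows "isometric E L"
proof (rule isometric_if_flip[OF assms(1,2)])
  fix s t assume st: "s \<in> L" "t \<in> L" "s \<noteq> t"
  then have sm: "s \<in> sign_maps E" "t \<in> sign_maps E" using assms(2) by auto
  then have "parallel E s t" unfolding parallel_def sign_maps_iff by force
  then obtain e where e: "e \<in> E" "s e \<noteq> t e" "s(e := t e) \<in> realization E L"
    using midface_property_imp_flip[OF assms(1,3), of s t] st sm by (auto simp: sign_maps_mem_Baryc_iff)
  have "s(e := t e) \<in> sign_maps E"
    using sm e(1) by (auto simp: sign_maps_iff extensional_def)
  then have "s(e := t e) \<in> L"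
    using e(3) sign_maps_Int_realization[of E L] by blast
  then show "\<exists>e\<in>E. s e \<noteq> t e \<and> s(e := t e) \<in> L" using e by blast
qed

lemma midface_property_imp_intrinsic_dist:
  assumes "finite E" "midface_property E L" "x \<in> realization E L" "y \<in> realization E L"
  shows "intrinsic_dist E L x y = ennreal (l1_dist E x y)"
  using assms realization_subset_extensional[of E L]
  by (intro stair_joined_imp_intrinsic_dist midface_property_imp_stair_joined) auto

text \<open>The gate is the coordinate projection: it keeps \<open>r\<close> on the free coordinates
  and takes the values of the face elsewhere. On |L| the intrinsic distance is the l1-distance, so
  gatedness can be checked per coordinate.\<close>

lemma midface_property_imp_gated:
  assumes "finite E" "midface_property E L" "F \<in> faces E L"
  shows "gated (realization E L) (intrinsic_dist E L) F"
  unfolding gated_def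
proof (intro conjI ballI)
  show sub: "F \<subseteq> realization E L" using assms(3) by (auto simp: realization_def)
  fix r assume r: "r \<in> realization E L"
  obtain A s where A: "A \<subseteq> E" "s \<in> sign_maps (E - A)" "F = cube_face E A s"
    using assms(3) by (auto simp: faces_def face_pairs_def)
  have F: "q \<in> F \<longleftrightarrow> q \<in> cube E \<and> (\<forall>e\<in>E - A. q e = s e)" for q
  proof -
    have "restrict q (E - A) = s \<longleftrightarrow> (\<forall>e\<in>E - A. q e = s e)"
      using A(2) by (auto simp: sign_maps_iff extensional_def restrict_def fun_eq_iff)
    then show ?thesis by (simp add: A(3) cube_face_def)
  qed
  define r' where "r' = (\<lambda>e\<in>E. if e \<in> A then r e else s e)"
  have "\<bar>r' e\<bar> \<le> 1" if "e \<in> E" for e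
    using realization_abs_le[OF r that] sign_maps_abs[OF A(2), of e] that by (auto simp: r'_def)
  then have r': "r' \<in> F" by (auto simp: F cube_iff r'_def)
  have "intrinsic_dist E L r q = intrinsic_dist E L r r' + intrinsic_dist E L r' q" if q: "q \<in> F" for q
  proof -
    have "l1_dist E r q = l1_dist E r r' + l1_dist E r' q"
      unfolding l1_dist_between_iff[OF assms(1)] using q by (auto simp: F r'_def)
    then have "ennreal (l1_dist E r q) = ennreal (l1_dist E r r') + ennreal (l1_dist E r' q)"
      by (simp add: l1_dist_nonneg)
    then show ?thesis
      using midface_property_imp_intrinsic_dist[OF assms(1,2)] r r' q sub by (auto simp: subset_iff)
  qed
  with r' show "\<exists>r'\<in>F. \<forall>q\<in>F. intrinsic_dist E L r q = intrinsic_dist E L r r' + intrinsic_dist E L r' q"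
    by blast
qed

lemma intrinsic_dist_parallel_imp_midface_property:
  assumes "finite E"
    and dist: "\<And>x y. x \<in> Baryc E L \<Longrightarrow> y \<in> Baryc E L \<Longrightarrow> parallel E x y \<Longrightarrow>
      intrinsic_dist E L x y = ennreal (l1_dist E x y)"
  shows "midface_property E L"
proof (rule midface_propertyI)
  fix x y assume xy: "x \<in> Baryc E L" "y \<in> Baryc E L" "parallel E x y" "x \<noteq> y"
  have ext: "x \<in> extensional E" "y \<in> extensional E"
    using xy realization_subset_extensional by (auto simp: Baryc_iff)
  obtain e where e: "e \<in> E" "x e \<noteq> y e" using xy(4) extensionalityI[OF ext] by blast
  have xe: "(x e = -1 \<and> y e = 1) \<or> (x e = 1 \<and> y e = -1)"
    using e xy(3) Baryc_cases[OF xy(1) e(1)] Baryc_cases[OF xy(2) e(1)]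
    unfolding parallel_def by (metis zero_neq_one zero_neq_neg_one)
  \<comment> \<open>With slack 1 the detour \<open>2 * \<bar>x f - z f\<bar>\<close> at a common
    coordinate \<open>f\<close> stays below 1. So \<open>z f\<close> is interior or equal to
    \<open>x f\<close>; the opposite sign is out of reach.\<close>
  have "intrinsic_dist E L x y < ennreal (l1_dist E x y + 1)"
    using dist[OF xy(1-3)] l1_dist_nonneg[of E x y] by (simp add: ennreal_lessI)
  then obtain \<gamma> where
    cont: "continuous_map (top_of_set {0..1}) (Metric_space.mtopology (realization E L) (l1_dist E)) \<gamma>"
    and ends: "\<gamma> 0 = x" "\<gamma> 1 = y" and len: "curve_length E \<gamma> < ennreal (l1_dist E x y + 1)"
    unfolding intrinsic_dist_def INF_less_iff by blast
  have \<gamma>: "\<gamma> ` {0..1} \<subseteq> realization E L" "continuous_on {0..1} (\<lambda>t. \<gamma> t e)"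
    using cont e(1) unfolding continuous_map_realization_iff[OF assms(1) realization_subset_extensional]
    by blast+
  obtain u where u: "0 \<le> u" "u \<le> 1" "\<gamma> u e = 0"
    using IVT'[OF _ _ _ \<gamma>(2), of 0] IVT2'[OF _ _ _ \<gamma>(2), of 0] xe by (auto simp: ends)
  define z where "z = \<gamma> u"
  have z: "z \<in> realization E L" using u \<gamma>(1) by (auto simp: z_def)
  have "ennreal (l1_dist E x z + l1_dist E z y) < ennreal (l1_dist E x y + 1)"
    using curve_length_ge_via[of u E \<gamma>] u len by (auto simp: ends z_def)
  then have short: "l1_dist E x z + l1_dist E z y < l1_dist E x y + 1"
    by (subst (asm) ennreal_less_iff) (auto simp: l1_dist_nonneg)
  have "z f = x f \<or> \<bar>z f\<bar> < 1" if f: "f \<in> E" "x f = y f" for f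
  proof -
    have "\<bar>x f - z f\<bar> + \<bar>z f - y f\<bar> - \<bar>x f - y f\<bar> \<le>
        (\<Sum>f\<in>E. \<bar>x f - z f\<bar> + \<bar>z f - y f\<bar> - \<bar>x f - y f\<bar>)"
      using f(1) assms(1) by (intro member_le_sum) auto
    also have "\<dots> = l1_dist E x z + l1_dist E z y - l1_dist E x y"
      by (simp add: l1_dist_def sum.distrib sum_subtractf)
    also have "\<dots> < 1" using short by simp
    finally have "2 * \<bar>x f - z f\<bar> < 1" using f(2) abs_minus_commute[of "z f" "y f"] by simp
    moreover have "x f = -1 \<or> x f = 0 \<or> x f = 1" using xy(1) f(1) by (auto simp: Baryc_iff)
    ultimately show ?thesis
      using realization_abs_le[OF z f(1)] by (auto simp: abs_if split: if_splits)
  qed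
  then show "\<exists>z\<in>realization E L. (\<forall>e\<in>E. x e = y e \<longrightarrow> z e = x e \<or> \<bar>z e\<bar> < 1) \<and>
        (\<exists>e\<in>E. x e \<noteq> y e \<and> \<bar>z e\<bar> < 1)"
    using z e u(3) by (intro bexI[of _ z] conjI bexI[of _ e]) (auto simp: z_def)
qed

text \<open>The gate of the barycenter \<open>x\<close> in the face of \<open>y\<close> is compared with two opposite vertices
  of that face. Isometry makes their distances to \<open>x\<close> as small as possible, which leaves no room
  for the gate to differ from \<open>y\<close>.\<close>

lemma isometric_gated_imp_intrinsic_dist:
  assumes "finite E" "L \<subseteq> sign_maps E" "isometric E L"
    and gated: "\<And>F. F \<in> faces E L \<Longrightarrow> gated (realization E L) (intrinsic_dist E L) F"
    and xy: "x \<in> Baryc E L" "y \<in> Baryc E L" "parallel E x y"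
  shows "intrinsic_dist E L x y = ennreal (l1_dist E x y)"
proof -
  have xr: "x \<in> realization E L" and yr: "y \<in> realization E L" using xy by (auto simp: Baryc_iff)
  have ext: "x \<in> extensional E" "y \<in> extensional E" using xr yr realization_subset_extensional by auto
  have par: "x e = 0 \<longleftrightarrow> y e = 0" if "e \<in> E" for e using xy(3) that by (auto simp: parallel_def)
  define corner where "corner w c = (\<lambda>e\<in>E. if w e = 0 then c else w e)" for w :: "'a \<Rightarrow> real" and c :: real
  have corner: "corner w c \<in> L" if "w \<in> Baryc E L" "c = -1 \<or> c = 1" for w c
  proof (rule realizationD[of w E])
    show "w \<in> realization E L" using that by (simp add: Baryc_iff)
    show "corner w c \<in> sign_maps E"
      using that by (auto simp: corner_def sign_maps_iff Baryc_iff)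
  qed (auto simp: corner_def)
  have Lr: "L \<subseteq> realization E L"
    using assms(2) sign_maps_Int_realization[of E L] by blast
  have joined: "stair_joined E L s t" if "s \<in> L" "t \<in> L" for s t
  proof (rule stair_joined_if_axis_steps[OF assms(1) Lr that])
    fix s t assume st: "s \<in> L" "t \<in> L" "s \<noteq> t"
    then obtain e where e: "e \<in> E" "s e \<noteq> t e" "s(e := t e) \<in> L"
      using isometric_flip[OF assms(1-3)] by blast
    have "s(e := c) \<in> realization E L" if c: "\<bar>c\<bar> \<le> 1" for c
      unfolding realization_iff
    proof (intro conjI ballI impI)
      have sm: "s \<in> sign_maps E" "t \<in> sign_maps E" using st assms(2) by auto
      show "s(e := c) \<in> cube E"
        using c sm(1) sign_maps_abs[OF sm(1)] e(1) by (auto simp: cube_iff sign_maps_iff extensional_def)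
      fix r assume r: "r \<in> sign_maps E" "\<forall>f\<in>E. \<bar>(s(e := c)) f\<bar> = 1 \<longrightarrow> r f = (s(e := c)) f"
      have eq: "r f = s f" if "f \<in> E" "f \<noteq> e" for f
        using r(2) that sign_maps_abs[OF sm(1)] by auto
      have "r e = s e \<or> r e = t e"
        using r(1) sm e(1,2) unfolding sign_maps_iff by metis
      then have "r = s \<or> r = s(e := t e)"
      proof (elim disj_forward)
        show "r = s" if "r e = s e"
          by (rule extensionalityI[of _ E]) (use r(1) sm eq that in \<open>auto simp: sign_maps_iff\<close>)
        show "r = s(e := t e)" if "r e = t e"
          by (rule extensionalityI[of _ E])
            (use r(1) sm eq that e(1) in \<open>auto simp: sign_maps_iff extensional_def\<close>)
      qed
      then show "r \<in> L" using st(1) e(3) by blast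
    qed
    then show "\<exists>e\<in>E. s e \<noteq> t e \<and>
      (s(e := t e) \<in> L \<and> (\<forall>c. \<bar>c\<bar> \<le> 1 \<longrightarrow> s(e := c) \<in> realization E L) \<or>
       t(e := s e) \<in> L \<and> (\<forall>c. \<bar>c\<bar> \<le> 1 \<longrightarrow> t(e := c) \<in> realization E L))"
      using e by blast
  qed
  \<comment> \<open>The path crosses the face of \<open>x\<close> diagonally to
    \<open>corner x c\<close> and then follows edges to \<open>corner y c\<close>. The first part
    moves only the zeros of \<open>x\<close>, where the two corners agree by parallelism, so no
    coordinate moves twice.\<close>
  have dist_corner: "intrinsic_dist E L x (corner y c) = ennreal (l1_dist E x (corner y c))"
    if c: "c = -1 \<or> c = 1" for c
  proof (rule stair_joined_imp_intrinsic_dist[OF assms(1)])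
    show "stair_joined E L x (corner y c)"
    proof (rule stair_joined_prepend[OF assms(1) joined[OF corner[OF xy(1) c] corner[OF xy(2) c]]])
      show "x e = corner x c e \<or> corner x c e = corner y c e" if "e \<in> E" for e
        using par[OF that] that by (auto simp: corner_def)
      fix d :: real assume d: "0 \<le> d" "d \<le> 1"
      have pt: "x e + d * (corner x c e - x e) = (if x e = 0 then d * c else x e)" if "e \<in> E" for e
        using that by (auto simp: corner_def)
      show "(\<lambda>e\<in>E. x e + d * (corner x c e - x e)) \<in> realization E L"
        unfolding realization_iff
      proof (intro conjI ballI impI)
        show "(\<lambda>e\<in>E. x e + d * (corner x c e - x e)) \<in> cube E"
          using pt realization_abs_le[OF xr] c d by (auto simp: cube_iff)
        fix r assume r: "r \<in> sign_maps E" "\<forall>e\<in>E. \<bar>(\<lambda>e\<in>E. x e + d * (corner x c e - x e)) e\<bar> = 1 \<longrightarrow>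
          r e = (\<lambda>e\<in>E. x e + d * (corner x c e - x e)) e"
        show "r \<in> L"
          by (rule realizationD[OF xr r(1)]) (use r(2) pt in fastforce)
      qed
    qed
  qed (use ext in \<open>auto simp: corner_def\<close>)
  define A where "A = {e\<in>E. y e = 0}"
  define F where "F = cube_face E A (restrict y (E - A))"
  have F: "q \<in> F \<longleftrightarrow> q \<in> cube E \<and> (\<forall>e\<in>E. y e \<noteq> 0 \<longrightarrow> q e = y e)" for q
    by (auto simp: F_def cube_face_def A_def restrict_def fun_eq_iff)
  have "restrict y (E - A) \<in> sign_maps (E - A)" using xy(2) by (auto simp: sign_maps_iff Baryc_iff A_def)
  moreover have "barycenter E A (restrict y (E - A)) = y"
    using ext by (auto simp: barycenter_def A_def extensional_def restrict_def fun_eq_iff)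
  ultimately have "(A, restrict y (E - A)) \<in> face_pairs E L"
    using barycenter_in_realization_iff[of A E "restrict y (E - A)" L] yr by (auto simp: A_def)
  then have "F \<in> faces E L" by (auto simp: faces_def F_def)
  from gated[OF this] xr obtain x' where x': "x' \<in> F"
    "\<And>q. q \<in> F \<Longrightarrow> intrinsic_dist E L x q = intrinsic_dist E L x x' + intrinsic_dist E L x' q"
    unfolding gated_def by blast
  have x'c: "x' \<in> cube E" and x'y: "\<And>e. e \<in> E \<Longrightarrow> y e \<noteq> 0 \<Longrightarrow> x' e = y e" using x'(1) by (auto simp: F)
  have cornerF: "corner y c \<in> F" if c: "c = -1 \<or> c = 1" for c
    unfolding F
  proof
    show "corner y c \<in> cube E" using c realization_abs_le[OF yr] by (auto simp: cube_iff corner_def)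
  qed (simp add: corner_def)
  have upper: "intrinsic_dist E L x x' + ennreal (l1_dist E x' (corner y c)) \<le> ennreal (l1_dist E x (corner y c))"
    if c: "c = -1 \<or> c = 1" for c
    using x'(2)[OF cornerF[OF c]] dist_corner[OF c]
      add_left_mono[OF intrinsic_dist_ge[of E x' "corner y c" L], of "intrinsic_dist E L x x'"] by simp
  have "intrinsic_dist E L x x' \<le> intrinsic_dist E L x x' + ennreal (l1_dist E x' (corner y 1))" by simp
  also have "\<dots> \<le> ennreal (l1_dist E x (corner y 1))" using upper by simp
  also have "\<dots> < top" by simp
  finally obtain \<rho> where \<rho>: "0 \<le> \<rho>" "intrinsic_dist E L x x' = ennreal \<rho>"
    by (cases "intrinsic_dist E L x x'") auto
  have le: "\<rho> + l1_dist E x' (corner y c) \<le> l1_dist E x (corner y c)" if c: "c = -1 \<or> c = 1" for c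
    using upper[OF c] \<rho> by (simp add: l1_dist_nonneg flip: ennreal_plus)
  \<comment> \<open>On the free coordinates the distances of \<open>x' e\<close> to 1 and to -1 add
    up to 2 wherever \<open>x' e\<close> lies, just as for \<open>x e = 0\<close>. Adding the bounds
    \<open>le\<close> for both corners thus cancels the unknown position of \<open>x'\<close> and
    leaves \<open>\<rho> \<le> l1_dist E x y\<close>.\<close>
  have "l1_dist E x' (corner y 1) + l1_dist E x' (corner y (-1)) + 2 * l1_dist E x y =
      l1_dist E x (corner y 1) + l1_dist E x (corner y (-1))"
    unfolding l1_dist_def sum_distrib_left sum.distrib[symmetric]
  proof (rule sum.cong[OF refl])
    fix e assume e: "e \<in> E"
    have "\<bar>x' e\<bar> \<le> 1" using x'c e by (auto simp: cube_iff)
    then show "\<bar>x' e - corner y 1 e\<bar> + \<bar>x' e - corner y (-1) e\<bar> + 2 * \<bar>x e - y e\<bar> =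
        \<bar>x e - corner y 1 e\<bar> + \<bar>x e - corner y (-1) e\<bar>"
      using x'y[OF e] par[OF e] e by (cases "y e = 0") (auto simp: corner_def)
  qed
  then have \<rho>le: "\<rho> \<le> l1_dist E x y" using le[of 1] le[of "-1"] by simp
  \<comment> \<open>Since \<open>\<rho>\<close> is at least the left side and at most
    \<open>l1_dist E x y\<close>, the gate has to be \<open>y\<close>.\<close>
  have "l1_dist E x x' = l1_dist E x y + l1_dist E y x'"
    unfolding l1_dist_between_iff[OF assms(1)]
  proof
    fix e assume "e \<in> E"
    then show "\<bar>x e - x' e\<bar> = \<bar>x e - y e\<bar> + \<bar>y e - x' e\<bar>"
      using x'y[of e] par[of e] by (cases "y e = 0") auto
  qed
  moreover have "l1_dist E x x' \<le> \<rho>" using intrinsic_dist_ge[of E x x' L] \<rho> by simp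
  ultimately have "l1_dist E y x' = 0" "\<rho> = l1_dist E x y"
    using \<rho>le l1_dist_nonneg[of E y x'] by auto
  moreover from this(1) have "y = x'"
    using x'c ext by (intro l1_dist_eq_0[OF assms(1)]) (auto simp: cube_iff)
  ultimately show ?thesis using \<rho> by simp
qed

theorem theorem1:
  fixes E :: "'a set" and L :: "('a \<Rightarrow> real) set"
  assumes "finite E" and "L \<subseteq> sign_maps E"
  shows "(ample E L \<longleftrightarrow> weakly_convex E (realization E L)) \<and>
    (ample E L \<longleftrightarrow> sign_convex E (realization E L)) \<and>
    (ample E L \<longleftrightarrow> sign_convex E (Baryc E L)) \<and>
    (ample E L \<longleftrightarrow>
      isometric E L \<and>
      (\<forall>F\<in>faces E L. gated (realization E L) (intrinsic_dist E L) F)) \<and>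
    (ample E L \<longleftrightarrow>
      (\<forall>t\<^sub>1\<in>Baryc E L. \<forall>t\<^sub>2\<in>Baryc E L.
        intrinsic_dist E L t\<^sub>1 t\<^sub>2 = ennreal (l1_dist E t\<^sub>1 t\<^sub>2))) \<and>
    (ample E L \<longleftrightarrow>
      (\<forall>A s\<^sub>1 s\<^sub>2. (A, s\<^sub>1) \<in> face_pairs E L \<longrightarrow> (A, s\<^sub>2) \<in> face_pairs E L \<longrightarrow>
        intrinsic_dist E L (barycenter E A s\<^sub>1) (barycenter E A s\<^sub>2) =
          ennreal (l1_dist E (barycenter E A s\<^sub>1) (barycenter E A s\<^sub>2))))"
proof -
  have vii: "(\<forall>A s\<^sub>1 s\<^sub>2. (A, s\<^sub>1) \<in> face_pairs E L \<longrightarrow> (A, s\<^sub>2) \<in> face_pairs E L \<longrightarrow>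
        intrinsic_dist E L (barycenter E A s\<^sub>1) (barycenter E A s\<^sub>2) =
          ennreal (l1_dist E (barycenter E A s\<^sub>1) (barycenter E A s\<^sub>2))) \<longleftrightarrow>
      (\<forall>x\<in>Baryc E L. \<forall>y\<in>Baryc E L. parallel E x y \<longrightarrow>
        intrinsic_dist E L x y = ennreal (l1_dist E x y))"
    unfolding parallel_def by (rule parallel_Baryc_iff)
  \<comment> \<open>Ampleness, the midface property, sign-convexity of |L| and sign-convexity of the
    barycenters form a cycle of implications, here closed back to ampleness.\<close>
  have iii: "ample E L" if "sign_convex E (realization E L)"
    using that sign_convex_realization_imp_Baryc sign_convex_Baryc_imp_ample[OF assms] by blast
  then have ample_iff_midface: "ample E L \<longleftrightarrow> midface_property E L"
    using ample_imp_midface_property[OF assms]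
      midface_property_imp_sign_convex_realization[OF assms(1)] by blast
  have "weakly_convex E (realization E L) \<longleftrightarrow> midface_property E L"
    using midface_property_imp_weakly_convex weakly_convex_imp_midface_property assms(1) by blast
  moreover have "sign_convex E (realization E L) \<longleftrightarrow> midface_property E L"
    using midface_property_imp_sign_convex_realization[OF assms(1)] iii ample_iff_midface by blast
  moreover have "sign_convex E (Baryc E L) \<longleftrightarrow> midface_property E L"
    using midface_property_imp_sign_convex_realization[OF assms(1)] ample_iff_midface
      sign_convex_realization_imp_Baryc sign_convex_Baryc_imp_ample[OF assms] by blast
  moreover have "isometric E L \<and> (\<forall>F\<in>faces E L. gated (realization E L) (intrinsic_dist E L) F) \<longleftrightarrow>
      midface_property E L"
    using midface_property_imp_isometric[OF assms] midface_property_imp_gated[OF assms(1)]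
      intrinsic_dist_parallel_imp_midface_property[OF assms(1)]
      isometric_gated_imp_intrinsic_dist[OF assms] by blast
  moreover have "(\<forall>x\<in>Baryc E L. \<forall>y\<in>Baryc E L. intrinsic_dist E L x y = ennreal (l1_dist E x y)) \<longleftrightarrow>
      midface_property E L"
    using midface_property_imp_intrinsic_dist[OF assms(1)]
      intrinsic_dist_parallel_imp_midface_property[OF assms(1)] by (auto simp: Baryc_iff)
  moreover have "(\<forall>x\<in>Baryc E L. \<forall>y\<in>Baryc E L. parallel E x y \<longrightarrow>
        intrinsic_dist E L x y = ennreal (l1_dist E x y)) \<longleftrightarrow> midface_property E L"
    using midface_property_imp_intrinsic_dist[OF assms(1)]
      intrinsic_dist_parallel_imp_midface_property[OF assms(1)] by (auto simp: Baryc_iff)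
  ultimately show ?thesis unfolding vii ample_iff_midface by blast
qed

end
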